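(* Consider the ranking-and-selection-with-covariates problem and Procedure FDHet described in the context, and assume (A1) the linear model with independent normal (possibly heteroscedastic) sampling errors and (A2) that $\mathcal X^\intercal\mathcal X$ is nonsingular. Then Procedure FDHet is statistically valid: $\mathrm{PCS}_{\mathrm E}\ge1-\alpha$ if $h=h^{\mathrm{Het}}_{\mathrm E}$, and $\mathrm{PCS}_{\min}\ge1-\alpha$ if $h=h^{\mathrm{Het}}_{\min}$.
   Context: There are $k$ alternatives. Covariates $\mathbf X_{\mathsf c}=(X_1,\dots,X_d)^\intercal$ are random with support $\Theta_{\mathsf c}\subseteq\mathbb R^d$; the augmented covariate vector is $\mathbf X=(1,X_1,\dots,X_d)^\intercal$ with support $\Theta=\{1\}\times\Theta_{\mathsf c}$. (A1) For each alternative $i$ and replication $\ell=1,2,\dots$, a sample of alternative $i$ at $\mathbf x\in\Theta$ is $Y_{i\ell}(\mathbf x)=\mathbf x^\intercal\boldsymbol\beta_i+\epsilon_{i\ell}(\mathbf x)$, with $\boldsymbol\beta_i\in\mathbb R^{d+1}$ unknown, $\epsilon_{i\ell}(\mathbf x)\sim\mathcal N(0,\sigma_i^2(\mathbf x))$, and $\epsilon_{i\ell}(\mathbf x)$ independent of $\epsilon_{i'\ell'}(\mathbf x')$ whenever $(i,\ell,\mathbf x)\neq(i',\ell',\mathbf x')$; samples are independent of $\mathbf X$. Fixed design: $m\ge d+1$ design points $\mathbf x_1,\dots,\mathbf x_m\in\Theta$, design matrix $\mathcal X=(\mathbf x_1,\dots,\mathbf x_m)^\intercal\in\mathbb R^{m\times(d+1)}$;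 each alternative may be sampled at each design point any number of times. (A2) $\mathcal X^\intercal\mathcal X$ is nonsingular. Let $i^*(\mathbf x)=\arg\max_i\mathbf x^\intercal\boldsymbol\beta_i$ and let $\widehat{i^*}(\mathbf x)$ be the random decision rule output by a procedure. For an indifference-zone parameter $\delta>0$, $\mathrm{PCS}(\mathbf x)=\mathbb P\big(\mathbf x^\intercal\boldsymbol\beta_{i^*(\mathbf x)}-\mathbf x^\intercal\boldsymbol\beta_{\widehat{i^*}(\mathbf x)}<\delta\big)$ (probability over the samples), $\mathrm{PCS}_{\mathrm E}=\mathbb E[\mathrm{PCS}(\mathbf X)]$ (expectation over $\mathbf X$), $\mathrm{PCS}_{\min}=\min_{\mathbf x\in\Theta}\mathrm{PCS}(\mathbf x)$. A target $1-\alpha\in(1/k,1)$ is given. Procedure FDHet. Setup: choose the form of unconditional PCS, $1-\alpha$, $\delta>0$, $n_0\ge2$. Let $\Phi$ be the standard normal cdf, $\gamma,\Gamma$ the pdf and cdf of the chi-squared distribution with $n_0-1$ degrees of freedom, and $\gamma_{(1)}(t)=m\gamma(t)(1-\Gamma(t))^{m-1}$ (pdf of the minimum of $m$ i.i.d. such variables). Let $h^{\mathrm{Het}}_{\mathrm E}$ solve $\mathbb E\Big\{\int_0^\infty\Big[\int_0^\infty\Phi\Big(\frac{h}{\sqrt{(n_0-1)(t^{-1}+s^{-1})\mathbf X^\intercal(\mathcal X^\intercal\mathcal X)^{-1}\mathbf X}}\Big)\gamma_{(1)}(s)\,ds\Big]^{k-1}\gamma_{(1)}(t)\,dt\Big\}=1-\alpha$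 (expectation over $\mathbf X$), and $h^{\mathrm{Het}}_{\min}$ solve the same equation with $\mathbb E$ replaced by $\min_{\mathbf x\in\Theta}$ and $\mathbf X$ by $\mathbf x$. Set $h$ to the one corresponding to the chosen form. Stage 1: take $n_0$ independent samples $Y_{i\ell}(\mathbf x_j)$, $\ell=1,\dots,n_0$, of each alternative $i$ at each design point $\mathbf x_j$; set $\overline Y_{ij}=\frac1{n_0}\sum_{\ell=1}^{n_0}Y_{i\ell}(\mathbf x_j)$ and $S_{ij}^2=\frac1{n_0-1}\sum_{\ell=1}^{n_0}(Y_{i\ell}(\mathbf x_j)-\overline Y_{ij})^2$. Stage 2: set $N_{ij}=\max\{\lceil h^2S_{ij}^2/\delta^2\rceil,n_0\}$ and take $N_{ij}-n_0$ further independent samples of alternative $i$ at $\mathbf x_j$. Selection: $\widehat Y_{ij}=\frac1{N_{ij}}\sum_{\ell=1}^{N_{ij}}Y_{i\ell}(\mathbf x_j)$, $\widehat{\mathbf Y}_i=(\widehat Y_{i1},\dots,\widehat Y_{im})^\intercal$, $\widehat{\boldsymbol\beta}_i=(\mathcal X^\intercal\mathcal X)^{-1}\mathcal X^\intercal\widehat{\mathbf Y}_i$; return $\widehat{i^*}(\mathbf x)=\arg\max_{1\le i\le k}\mathbf x^\intercal\widehat{\boldsymbol\beta}_i$. *)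

theory Defs
  imports "HOL-Probability.Probability"
begin

definition Phi :: "real \<Rightarrow> real" where
  "Phi t = (LINT u:{..t}|lborel. std_normal_density u)"

definition chi2_pdf :: "nat \<Rightarrow> real \<Rightarrow> real" where
  "chi2_pdf nu t = (if t \<le> 0 then 0 else
     t powr (real nu / 2 - 1) * exp (- t / 2) / (2 powr (real nu / 2) * Gamma (real nu / 2)))"

definition chi2_cdf :: "nat \<Rightarrow> real \<Rightarrow> real" where
  "chi2_cdf nu t = (LINT u:{0..t}|lborel. chi2_pdf nu u)"

definition chi2_min_pdf :: "nat \<Rightarrow> nat \<Rightarrow> real \<Rightarrow> real" where
  "chi2_min_pdf m nu t = real m * chi2_pdf nu t * (1 - chi2_cdf nu t) ^ (m - 1)"

definition design_matrix :: "('m::finite \<Rightarrow> real^'p::finite) \<Rightarrow> real^'p^'m" where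
  "design_matrix xd = (\<chi> j. xd j)"

text \<open>Left-hand side integrand of the equation defining h (before E or min over x).
  k alternatives, m = CARD('m) design points, first-stage size n0.\<close>
definition het_integrand ::
  "nat \<Rightarrow> nat \<Rightarrow> ('m::finite \<Rightarrow> real^'p::finite) \<Rightarrow> real \<Rightarrow> real^'p \<Rightarrow> real" where
  "het_integrand k n0 xd h x =
     (let G = matrix_inv (transpose (design_matrix xd) ** design_matrix xd);
          g = chi2_min_pdf CARD('m) (n0 - 1)
      in LINT t:{0<..}|lborel.
           (LINT s:{0<..}|lborel.
              Phi (h / sqrt ((real n0 - 1) * (1 / t + 1 / s) * (x \<bullet> (G *v x)))) * g s) ^ (k - 1)
           * g t)"

text \<open>Stage-1/Stage-2 quantities for one alternative at one design point;
  ys l is the (l+1)-th sample (l = 0,1,2,...).\<close>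
definition fd_first_mean :: "nat \<Rightarrow> (nat \<Rightarrow> real) \<Rightarrow> real" where
  "fd_first_mean n0 ys = (\<Sum>l<n0. ys l) / real n0"

definition fd_first_var :: "nat \<Rightarrow> (nat \<Rightarrow> real) \<Rightarrow> real" where
  "fd_first_var n0 ys = (\<Sum>l<n0. (ys l - fd_first_mean n0 ys)\<^sup>2) / (real n0 - 1)"

definition fd_N :: "real \<Rightarrow> real \<Rightarrow> nat \<Rightarrow> (nat \<Rightarrow> real) \<Rightarrow> nat" where
  "fd_N h \<delta> n0 ys = max (nat \<lceil>h\<^sup>2 * fd_first_var n0 ys / \<delta>\<^sup>2\<rceil>) n0"

definition fd_mean :: "real \<Rightarrow> real \<Rightarrow> nat \<Rightarrow> (nat \<Rightarrow> real) \<Rightarrow> real" where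
  "fd_mean h \<delta> n0 ys = (\<Sum>l<fd_N h \<delta> n0 ys. ys l) / real (fd_N h \<delta> n0 ys)"

definition fd_beta :: "('m::finite \<Rightarrow> real^'p::finite) \<Rightarrow> ('m \<Rightarrow> real) \<Rightarrow> real^'p" where
  "fd_beta xd yh = matrix_inv (transpose (design_matrix xd) ** design_matrix xd)
                     *v (transpose (design_matrix xd) *v (\<chi> j. yh j))"

definition argmax_alt :: "nat \<Rightarrow> (nat \<Rightarrow> real^'p::finite) \<Rightarrow> real^'p \<Rightarrow> nat" where
  "argmax_alt k b x = (LEAST i. i < k \<and> (\<forall>i'<k. x \<bullet> b i' \<le> x \<bullet> b i))"

text \<open>Decision of Procedure FDHet at covariate x, outcome w; Y i l j w is the (l+1)-th
  sample of alternative i at design point j.\<close>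
definition FDHet_select ::
  "nat \<Rightarrow> real \<Rightarrow> real \<Rightarrow> nat \<Rightarrow> ('m::finite \<Rightarrow> real^'p::finite)
     \<Rightarrow> (nat \<Rightarrow> nat \<Rightarrow> 'm \<Rightarrow> 'a \<Rightarrow> real) \<Rightarrow> real^'p \<Rightarrow> 'a \<Rightarrow> nat" where
  "FDHet_select k h \<delta> n0 xd Y x w =
     argmax_alt k (\<lambda>i. fd_beta xd (\<lambda>j. fd_mean h \<delta> n0 (\<lambda>l. Y i l j w))) x"

definition FDHet_PCS ::
  "'a measure \<Rightarrow> nat \<Rightarrow> real \<Rightarrow> real \<Rightarrow> nat \<Rightarrow> ('m::finite \<Rightarrow> real^'p::finite)
     \<Rightarrow> (nat \<Rightarrow> nat \<Rightarrow> 'm \<Rightarrow> 'a \<Rightarrow> real) \<Rightarrow> (nat \<Rightarrow> real^'p) \<Rightarrow> real^'p \<Rightarrow> real" where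
  "FDHet_PCS M k h \<delta> n0 xd Y \<beta> x =
     measure M {w \<in> space M.
        (MAX i\<in>{..<k}. x \<bullet> \<beta> i) - x \<bullet> \<beta> (FDHet_select k h \<delta> n0 xd Y x w) < \<delta>}"

end

theory Submission
  imports Defs
begin

text \<open>
  Fix a covariate \<open>x\<close>. The estimate of \<open>x\<^sup>T \<beta>\<^sub>i\<close> is a fixed linear combination, with weights of squared norm
  \<open>v = x\<^sup>T (X\<^sup>T X)\<^sup>-\<^sup>1 x\<close>, of the sample means at the design points. The first-stage variance is
  independent of every sample mean over at least \<open>n0\<close> samples, so given the first-stage variances the
  estimation errors \<open>D\<^sub>i\<close> are independent centred normals; since \<open>N\<^sub>i\<^sub>j \<ge> h\<^sup>2 S\<^sub>i\<^sub>j\<^sup>2 / \<delta>\<^sup>2\<close>, the variance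
  of \<open>D\<^sub>i\<close> is at most \<open>(\<delta>/h)\<^sup>2 (n0 - 1) v\<close> divided by the minimum over \<open>j\<close> of independent chi-squared
  variables. With \<open>s\<close> the best alternative, selection is correct as soon as \<open>D\<^sub>i < \<delta> + D\<^sub>s\<close> for all \<open>i \<noteq> s\<close>.
  Given \<open>D\<^sub>s\<close> these events are independent with probabilities increasing in \<open>D\<^sub>s\<close>, and Chebyshev's
  association inequality (in place of Slepian's) bounds the probability below by the integrand of the
  equation defining \<open>h\<close>. A nonpositive \<open>h\<close> cannot solve that equation, because the integrand would
  then be at most \<open>2\<^sup>1\<^sup>-\<^sup>k \<le> 1/k\<close>.
\<close>

section \<open>Normal and chi-squared distributions\<close>

definition std_normal :: "real measure" where
  "std_normal = density lborel (\<lambda>x. ennreal (std_normal_density x))"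

definition chi2 :: "nat \<Rightarrow> real measure" where
  "chi2 \<nu> = density lborel (\<lambda>x. ennreal (chi2_pdf \<nu> x))"

lemma sets_std_normal [measurable_cong, simp]: "sets std_normal = sets borel"
  by (simp add: std_normal_def)

lemma space_std_normal [simp]: "space std_normal = UNIV"
  by (simp add: std_normal_def)

lemma sets_chi2 [measurable_cong, simp]: "sets (chi2 \<nu>) = sets borel"
  by (simp add: chi2_def)

lemma space_chi2 [simp]: "space (chi2 \<nu>) = UNIV"
  by (simp add: chi2_def)

lemma chi2_pdf_nonneg [simp]: "0 \<le> chi2_pdf \<nu> t"
proof (cases "\<nu> = 0")
  case False
  then have "Gamma (real \<nu> / 2) > 0" by (intro Gamma_real_pos) auto
  then show ?thesis by (simp add: chi2_pdf_def)
qed (simp add: chi2_pdf_def)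

lemma borel_measurable_chi2_pdf [measurable]: "chi2_pdf \<nu> \<in> borel_measurable borel"
  unfolding chi2_pdf_def[abs_def] by measurable

lemma prob_space_std_normal: "prob_space std_normal"
  unfolding std_normal_def by (rule prob_space_normal_density) simp

interpretation std_normal: prob_space std_normal
  by (rule prob_space_std_normal)

lemma emeasure_std_normal_UNIV [simp]: "emeasure std_normal UNIV = 1"
  using std_normal.emeasure_space_1 by simp

lemma nn_integral_std_normal:
  assumes [measurable]: "f \<in> borel_measurable borel"
  shows "(\<integral>\<^sup>+x. f x \<partial>std_normal) = (\<integral>\<^sup>+x. ennreal (std_normal_density x) * f x \<partial>lborel)"
  unfolding std_normal_def by (subst nn_integral_density) auto

lemma std_normal_density_rotate:
  assumes "c\<^sup>2 + s\<^sup>2 = 1"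
  shows "std_normal_density (c * u - s * v) * std_normal_density (s * u + c * v)
    = std_normal_density u * std_normal_density v"
proof -
  have "(c * u - s * v)\<^sup>2 + (s * u + c * v)\<^sup>2 = (c\<^sup>2 + s\<^sup>2) * (u\<^sup>2 + v\<^sup>2)"
    by (simp add: power2_eq_square algebra_simps)
  then have "(c * u - s * v)\<^sup>2 + (s * u + c * v)\<^sup>2 = u\<^sup>2 + v\<^sup>2"
    using assms by simp
  then show ?thesis
    by (simp add: std_normal_density_def exp_add[symmetric] field_simps add_divide_distrib[symmetric])
qed

lemma nn_integral_std_normal_rotate:
  fixes f :: "real \<times> real \<Rightarrow> ennreal"
  assumes [measurable]: "f \<in> borel_measurable (borel \<Otimes>\<^sub>M borel)"
    and c: "c \<noteq> 0" and cs: "c\<^sup>2 + s\<^sup>2 = 1"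
  shows "(\<integral>\<^sup>+u. \<integral>\<^sup>+v. f (c * u + s * v, c * v - s * u) \<partial>std_normal \<partial>std_normal)
    = (\<integral>\<^sup>+u. \<integral>\<^sup>+v. f (u, v) \<partial>std_normal \<partial>std_normal)"
proof -
  let ?\<phi> = "std_normal_density"
  have "(\<integral>\<^sup>+u. \<integral>\<^sup>+v. f (c * u + s * v, c * v - s * u) \<partial>std_normal \<partial>std_normal)
      = (\<integral>\<^sup>+u. \<integral>\<^sup>+v. ennreal (?\<phi> u * ?\<phi> v) * f (c * u + s * v, c * v - s * u) \<partial>lborel \<partial>lborel)"
    by (simp add: nn_integral_std_normal nn_integral_cmult[symmetric] ennreal_mult mult.assoc)
  also have "\<dots> = (\<integral>\<^sup>+v. \<integral>\<^sup>+u. ennreal (?\<phi> u * ?\<phi> v) * f (c * u + s * v, c * v - s * u) \<partial>lborel \<partial>lborel)"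
    by (rule lborel_pair.Fubini') measurable
  also have "\<dots> = (\<integral>\<^sup>+v. ennreal \<bar>1/c\<bar> * (\<integral>\<^sup>+u. ennreal (?\<phi> (-(s/c) * v + (1/c) * u) * ?\<phi> v) *
        f (c * (-(s/c) * v + (1/c) * u) + s * v, c * v - s * (-(s/c) * v + (1/c) * u)) \<partial>lborel) \<partial>lborel)"
    using c by (intro nn_integral_cong nn_integral_real_affine) auto
  also have "\<dots> = (\<integral>\<^sup>+v. \<integral>\<^sup>+u. ennreal \<bar>1/c\<bar> * (ennreal (?\<phi> ((u - s * v) / c) * ?\<phi> v) * f (u, (v - s * u) / c)) \<partial>lborel \<partial>lborel)"
  proof -
    have "c * v - s * (-(s/c) * v + (1/c) * u) = ((c\<^sup>2 + s\<^sup>2) * v - s * u) / c" for u v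
      using c by (simp add: field_simps power2_eq_square)
    moreover have "-(s/c) * v + (1/c) * u = (u - s * v) / c" for u v
      using c by (simp add: field_simps)
    ultimately show ?thesis
      using c unfolding cs by (simp add: nn_integral_cmult)
  qed
  also have "\<dots> = (\<integral>\<^sup>+u. \<integral>\<^sup>+v. ennreal \<bar>1/c\<bar> * (ennreal (?\<phi> ((u - s * v) / c) * ?\<phi> v) * f (u, (v - s * u) / c)) \<partial>lborel \<partial>lborel)"
    by (rule lborel_pair.Fubini') measurable
  also have "\<dots> = (\<integral>\<^sup>+u. ennreal \<bar>c\<bar> * (\<integral>\<^sup>+v. ennreal \<bar>1/c\<bar> * (ennreal (?\<phi> ((u - s * (s * u + c * v)) / c) * ?\<phi> (s * u + c * v)) * f (u, ((s * u + c * v) - s * u) / c)) \<partial>lborel) \<partial>lborel)"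
    using c by (intro nn_integral_cong nn_integral_real_affine) auto
  also have "\<dots> = (\<integral>\<^sup>+u. \<integral>\<^sup>+v. ennreal (?\<phi> u * ?\<phi> v) * f (u, v) \<partial>lborel \<partial>lborel)"
  proof -
    have "(u - s * (s * u + c * v)) / c = ((c\<^sup>2 + s\<^sup>2 - s\<^sup>2) * u - s * c * v) / c" for u v
      unfolding cs by (simp add: power2_eq_square algebra_simps)
    also have "\<dots> u v = c * u - s * v" for u v
      using c by (simp add: field_simps power2_eq_square)
    finally have "(u - s * (s * u + c * v)) / c = c * u - s * v" for u v .
    moreover have "ennreal \<bar>c\<bar> * (ennreal \<bar>1/c\<bar> * a) = a" for a
      using c by (simp add: mult.assoc[symmetric] ennreal_mult[symmetric] abs_mult[symmetric])
    ultimately show ?thesis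
      using c by (simp add: nn_integral_cmult[symmetric] std_normal_density_rotate[OF cs])
  qed
  also have "\<dots> = (\<integral>\<^sup>+u. \<integral>\<^sup>+v. f (u, v) \<partial>std_normal \<partial>std_normal)"
    by (simp add: nn_integral_std_normal nn_integral_cmult[symmetric] ennreal_mult mult.assoc)
  finally show ?thesis .
qed

lemma nn_integral_std_normal_uminus:
  assumes [measurable]: "f \<in> borel_measurable borel"
  shows "(\<integral>\<^sup>+x. f (- x) \<partial>std_normal) = (\<integral>\<^sup>+x. f x \<partial>std_normal)"
  using nn_integral_real_affine[of "\<lambda>x. ennreal (std_normal_density x) * f x" "-1" 0]
  by (simp add: nn_integral_std_normal std_normal_density_def)

lemma nn_integral_std_normal_add:
  fixes f :: "real \<Rightarrow> ennreal"
  assumes [measurable]: "f \<in> borel_measurable borel"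
  shows "(\<integral>\<^sup>+u. \<integral>\<^sup>+v. f (a * u + b * v) \<partial>std_normal \<partial>std_normal)
    = (\<integral>\<^sup>+u. f (sqrt (a\<^sup>2 + b\<^sup>2) * u) \<partial>std_normal)"
proof (cases "a = 0")
  case True
  then show ?thesis
    using nn_integral_std_normal_uminus[of "\<lambda>u. f (b * u)"]
    by (cases "b \<ge> 0") (simp_all)
next
  case False
  define r where "r = sqrt (a\<^sup>2 + b\<^sup>2)"
  have "r > 0" using False by (simp add: r_def add_pos_nonneg)
  moreover have "(a/r)\<^sup>2 + (b/r)\<^sup>2 = 1"
    using \<open>r > 0\<close> by (simp add: power_divide add_divide_distrib[symmetric]) (simp add: r_def)
  ultimately show ?thesis
    using nn_integral_std_normal_rotate[of "\<lambda>(u, v). f (r * u)" "a/r" "b/r"] False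
    by (simp add: r_def[symmetric] distrib_left)
qed

lemma chi2_pdf_1_square:
  assumes "0 < u"
  shows "2 * u * chi2_pdf 1 (u\<^sup>2) = 2 * std_normal_density u"
proof -
  have "(u\<^sup>2) powr (- (1/2)) = 1 / u"
    using assms by (simp add: powr_minus powr_half_sqrt field_simps)
  moreover have "2 powr (1/2) * sqrt pi = sqrt (2 * pi)"
    by (simp add: powr_half_sqrt real_sqrt_mult)
  ultimately show ?thesis
    using assms by (simp add: chi2_pdf_def std_normal_density_def Gamma_one_half_real mult.assoc[symmetric])
qed

lemma distr_std_normal_square: "distr std_normal borel (\<lambda>u. u\<^sup>2) = chi2 1"
proof (rule measure_eqI)
  fix A :: "real set" assume "A \<in> sets (distr std_normal borel (\<lambda>u. u\<^sup>2))"
  then have A [measurable]: "A \<in> sets borel" by simp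
  let ?f = "\<lambda>t. indicator A t * chi2_pdf 1 t"
  let ?F = "\<lambda>u. 2 * (indicator A (u\<^sup>2) * std_normal_density u) :: real"
  let ?S = "{0<..} :: real set"
  have "integrable lborel (\<lambda>u. 2 * std_normal_density u)"
    using integrable_normal_moment[of 1 0 0] by simp
  then have "integrable lborel (\<lambda>u. indicator ?S u *\<^sub>R ?F u)"
    by (rule Bochner_Integration.integrable_bound) (auto simp: indicator_def)
  then have F: "?F absolutely_integrable_on ?S"
    by (simp add: set_integrable_def integrable_completion)
  have F_eq: "\<bar>2 * u\<bar> * ?f (u\<^sup>2) = ?F u" if "u \<in> ?S" for u
    using chi2_pdf_1_square[of u] that by (simp add: indicator_def)
  define b where "b = integral ?S ?F"
  have img: "(\<lambda>u. u\<^sup>2) ` ?S = ?S"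
  proof (intro equalityI subsetI)
    fix t :: real assume "t \<in> ?S"
    then have "t = (sqrt t)\<^sup>2" "sqrt t \<in> ?S" by auto
    then show "t \<in> (\<lambda>u. u\<^sup>2) ` ?S" by blast
  qed auto
  have der: "((\<lambda>u. u\<^sup>2) has_real_derivative 2 * u) (at u within ?S)" for u :: real
    by (auto intro!: derivative_eq_intros)
  have inj: "inj_on (\<lambda>u::real. u\<^sup>2) ?S"
    by (auto intro!: inj_onI)
  have "(\<lambda>u. \<bar>2 * u\<bar> * ?f (u\<^sup>2)) absolutely_integrable_on ?S"
  proof -
    have "(\<lambda>u. \<bar>2 * u\<bar> * ?f (u\<^sup>2)) absolutely_integrable_on ?S \<longleftrightarrow> ?F absolutely_integrable_on ?S"
      by (intro set_integrable_cong refl F_eq)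
    with F show ?thesis by blast
  qed
  moreover have "integral ?S (\<lambda>u. \<bar>2 * u\<bar> * ?f (u\<^sup>2)) = b"
    unfolding b_def by (rule integral_cong) (rule F_eq)
  ultimately have "?f absolutely_integrable_on ?S \<and> integral ?S ?f = b"
    using has_absolute_integral_change_of_variables_1'[of ?S "\<lambda>u. u\<^sup>2" "\<lambda>u. 2 * u" ?f b, OF _ der inj]
    unfolding img by simp
  then have "(?f has_integral b) ?S"
    using integrable_integral set_lebesgue_integral_eq_integral(1) by blast
  then have "((\<lambda>t. if t \<in> ?S then ?f t else 0) has_integral b) UNIV"
    by (simp only: has_integral_restrict_UNIV)
  then have f_int: "(\<integral>\<^sup>+t. ennreal (if t \<in> ?S then ?f t else 0) \<partial>lborel) = ennreal b"
    by (intro nn_integral_has_integral_lborel) auto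
  have "(?F has_integral b) ?S"
    using F integrable_integral set_lebesgue_integral_eq_integral(1) unfolding b_def by blast
  then have "((\<lambda>t. if t \<in> ?S then ?F t else 0) has_integral b) UNIV"
    by (simp only: has_integral_restrict_UNIV)
  then have F_int: "(\<integral>\<^sup>+t. ennreal (if t \<in> ?S then ?F t else 0) \<partial>lborel) = ennreal b"
    by (intro nn_integral_has_integral_lborel) auto
  let ?G = "\<lambda>u. ennreal (indicator A (u\<^sup>2) * std_normal_density u)"
  have "emeasure (distr std_normal borel (\<lambda>u. u\<^sup>2)) A = (\<integral>\<^sup>+u. indicator A (u\<^sup>2) \<partial>std_normal)"
    using nn_integral_distr[of "\<lambda>u. u\<^sup>2" std_normal borel "indicator A"] by simp
  also have "\<dots> = (\<integral>\<^sup>+u. ?G u \<partial>lborel)"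
    by (subst nn_integral_std_normal) (auto intro!: nn_integral_cong simp: indicator_def)
  also have "\<dots> = (\<integral>\<^sup>+u. ?G u * indicator {0<..} u + ?G u * indicator {..<0} u \<partial>lborel)"
    by (intro nn_integral_cong_AE eventually_mono[OF AE_lborel_singleton[of 0]]) (auto simp: indicator_def)
  also have "\<dots> = (\<integral>\<^sup>+u. ?G u * indicator {0<..} u \<partial>lborel) + (\<integral>\<^sup>+u. ?G u * indicator {..<0} u \<partial>lborel)"
    by (subst nn_integral_add) auto
  also have "(\<integral>\<^sup>+u. ?G u * indicator {..<0} u \<partial>lborel) = (\<integral>\<^sup>+u. ?G u * indicator {0<..} u \<partial>lborel)"
    by (subst nn_integral_real_affine[where t=0 and c="-1"])
      (auto intro!: nn_integral_cong simp: indicator_def std_normal_density_def)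
  also have "(\<integral>\<^sup>+u. ?G u * indicator {0<..} u \<partial>lborel) + (\<integral>\<^sup>+u. ?G u * indicator {0<..} u \<partial>lborel)
      = (\<integral>\<^sup>+u. ?G u * indicator {0<..} u + ?G u * indicator {0<..} u \<partial>lborel)"
    by (subst nn_integral_add) auto
  also have "\<dots> = (\<integral>\<^sup>+t. ennreal (if t \<in> ?S then ?F t else 0) \<partial>lborel)"
    by (intro nn_integral_cong) (auto simp: indicator_def ennreal_plus[symmetric] simp del: ennreal_plus)
  also have "\<dots> = (\<integral>\<^sup>+t. ennreal (if t \<in> ?S then ?f t else 0) \<partial>lborel)"
    by (simp only: F_int f_int)
  also have "\<dots> = emeasure (chi2 1) A"
    unfolding chi2_def by (subst emeasure_density) (auto intro!: nn_integral_cong simp: indicator_def chi2_pdf_def)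
  finally show "emeasure (distr std_normal borel (\<lambda>u. u\<^sup>2)) A = emeasure (chi2 1) A" .
qed simp

lemma chi2_pdf_convolution:
  assumes "1 \<le> \<nu>"
  shows "(\<integral>\<^sup>+y. ennreal (chi2_pdf \<nu> (x - y)) * ennreal (chi2_pdf 1 y) \<partial>lborel) = ennreal (chi2_pdf (Suc \<nu>) x)"
proof (cases "x \<le> 0")
  case True
  then have "ennreal (chi2_pdf \<nu> (x - y)) * ennreal (chi2_pdf 1 y) = 0" for y
    by (auto simp: chi2_pdf_def)
  then show ?thesis using True by (simp only: nn_integral_0_iff_AE) (simp add: chi2_pdf_def)
next
  case False
  then have x: "x > 0" by simp
  let ?a = "real \<nu> / 2"
  have a: "?a > 0" using assms by simp
  define K where "K = x powr (?a - 1) * x powr (- (1/2)) * exp (- x / 2)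
     / (2 powr ?a * Gamma ?a * (2 powr (1/2) * Gamma (1/2)))"
  have K: "0 \<le> K"
    unfolding K_def using Gamma_real_pos[OF a] Gamma_real_pos[of "1/2"] by simp
  let ?B = "\<lambda>u::real. if u \<in> {0..1} then u powr (1/2 - 1) * (1 - u) powr (?a - 1) else 0"
  have "((\<lambda>u. u powr (1/2 - 1) * (1 - u) powr (?a - 1)) has_integral Beta (1/2) ?a) {0..1}"
    using a by (intro has_integral_Beta_real) auto
  then have "(?B has_integral Beta (1/2) ?a) UNIV"
    by (simp only: has_integral_restrict_UNIV)
  then have B: "(\<integral>\<^sup>+u. ennreal (?B u) \<partial>lborel) = ennreal (Beta (1/2) ?a)"
    by (intro nn_integral_has_integral_lborel) auto
  have eq: "chi2_pdf \<nu> (x - x * u) * chi2_pdf 1 (x * u) = K * ?B u" if "u \<noteq> 0" "u \<noteq> 1" for u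
  proof (cases "0 < u \<and> u < 1")
    case True
    then have u: "x - x * u = x * (1 - u)" "0 < x * (1 - u)" "0 < x * u" using x by (auto simp: algebra_simps)
    have E: "exp (- (x * (1 - u)) / 2) * exp (- (x * u) / 2) = exp (- x / 2)"
      by (simp add: exp_add[symmetric] field_simps)
    have 1: "chi2_pdf \<nu> (x - x * u)
        = x powr (?a - 1) * (1 - u) powr (?a - 1) * exp (- (x * (1 - u)) / 2) / (2 powr ?a * Gamma ?a)"
      unfolding u(1) using u(2) True x by (simp add: chi2_pdf_def powr_mult not_le[symmetric])
    have 2: "chi2_pdf 1 (x * u)
        = x powr (- (1/2)) * u powr (1/2 - 1) * exp (- (x * u) / 2) / (2 powr (1/2) * Gamma (1/2))"
      using u(3) True x by (simp add: chi2_pdf_def powr_mult not_le[symmetric])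
    show ?thesis
      unfolding 1 2 K_def E[symmetric] using True by simp
  next
    case False
    then show ?thesis using that x by (auto simp: chi2_pdf_def mult_le_0_iff not_less zero_less_mult_iff)
  qed
  have "(\<integral>\<^sup>+y. ennreal (chi2_pdf \<nu> (x - y)) * ennreal (chi2_pdf 1 y) \<partial>lborel)
      = ennreal \<bar>x\<bar> * (\<integral>\<^sup>+u. ennreal (chi2_pdf \<nu> (x - (0 + x * u))) * ennreal (chi2_pdf 1 (0 + x * u)) \<partial>lborel)"
    using x by (intro nn_integral_real_affine) auto
  also have "(\<integral>\<^sup>+u. ennreal (chi2_pdf \<nu> (x - (0 + x * u))) * ennreal (chi2_pdf 1 (0 + x * u)) \<partial>lborel)
      = (\<integral>\<^sup>+u. ennreal K * ennreal (?B u) \<partial>lborel)"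
    by (intro nn_integral_cong_AE eventually_mono[OF eventually_conj[OF AE_lborel_singleton[of 0] AE_lborel_singleton[of 1]]])
      (use eq K in \<open>simp add: ennreal_mult[symmetric] del: One_nat_def\<close>)
  also have "\<dots> = ennreal K * ennreal (Beta (1/2) ?a)"
    by (subst nn_integral_cmult, measurable) (simp only: B)
  also have "ennreal \<bar>x\<bar> * \<dots> = ennreal (x * K * Beta (1/2) ?a)"
    using x K by (simp add: ennreal_mult' mult.assoc)
  also have "x * K * Beta (1/2) ?a = chi2_pdf (Suc \<nu>) x"
  proof -
    have e: "real (Suc \<nu>) / 2 = ?a + 1/2" by (simp add: add_divide_distrib)
    have p: "x * (x powr (?a - 1) * x powr (- (1/2))) = x powr (?a + 1/2 - 1)"
      using x powr_add[of x "?a - 1" "-(1/2)"] powr_mult_base[of x "?a - 1 - 1/2"]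
      by (simp add: algebra_simps)
    have "Gamma ?a > 0" "Gamma (1/2 :: real) \<noteq> 0" "Gamma (?a + 1/2) > 0"
      using a by (auto intro: Gamma_real_pos simp: Gamma_one_half_real)
    then show ?thesis
      unfolding chi2_pdf_def e K_def Beta_def powr_add[of 2 ?a] p[symmetric]
      using x by (simp add: field_simps)
  qed
  finally show ?thesis .
qed

lemma prob_space_chi2_1: "prob_space (chi2 1)"
  unfolding distr_std_normal_square[symmetric] by (rule std_normal.prob_space_distr) simp

lemma prob_space_chi2_convolution_chi2:
  assumes "1 \<le> \<nu>"
  shows "prob_space (chi2 \<nu>) \<and> chi2 (Suc \<nu>) = distr (chi2 \<nu> \<Otimes>\<^sub>M chi2 1) borel (\<lambda>(x, y). x + y)"
  using assms
proof (induction \<nu> rule: dec_induct)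
  have step: "chi2 (Suc \<nu>) = distr (chi2 \<nu> \<Otimes>\<^sub>M chi2 1) borel (\<lambda>(x, y). x + y)"
    if "1 \<le> \<nu>" "prob_space (chi2 \<nu>)" for \<nu>
  proof -
    interpret A: prob_space "chi2 \<nu>" by fact
    interpret B: prob_space "chi2 1" by (rule prob_space_chi2_1)
    have "chi2 \<nu> \<star> chi2 1 = density lborel (\<lambda>x. \<integral>\<^sup>+y. ennreal (chi2_pdf \<nu> (x - y)) * ennreal (chi2_pdf 1 y) \<partial>lborel)"
      using A.finite_measure_axioms B.finite_measure_axioms
      unfolding chi2_def by (intro convolution_density) auto
    then show ?thesis
      unfolding chi2_pdf_convolution[OF that(1)] by (simp add: chi2_def[symmetric] convolution_def)
  qed
  {
    case base
    show ?case using step[OF _ prob_space_chi2_1] prob_space_chi2_1 by simp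
  next
    case (step n)
    interpret A: prob_space "chi2 n" using step by simp
    interpret B: prob_space "chi2 1" by (rule prob_space_chi2_1)
    interpret pair_prob_space "chi2 n" "chi2 1" ..
    have "prob_space (distr (chi2 n \<Otimes>\<^sub>M chi2 1) borel (\<lambda>(x, y). x + y))"
      by (rule prob_space_distr) measurable
    then have "prob_space (chi2 (Suc n))" using step by simp
    then show ?case using \<open>\<And>\<nu>. \<lbrakk>1 \<le> \<nu>; prob_space (chi2 \<nu>)\<rbrakk> \<Longrightarrow> _\<close> by simp
  }
qed

lemmas prob_space_chi2 = prob_space_chi2_convolution_chi2[THEN conjunct1]

lemma nn_integral_chi2_Suc:
  fixes f :: "real \<Rightarrow> ennreal"
  assumes \<nu>: "1 \<le> \<nu>" and [measurable]: "f \<in> borel_measurable borel"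
  shows "(\<integral>\<^sup>+w. f w \<partial>chi2 (Suc \<nu>)) = (\<integral>\<^sup>+w. \<integral>\<^sup>+u. f (w + u\<^sup>2) \<partial>std_normal \<partial>chi2 \<nu>)"
proof -
  interpret A: prob_space "chi2 \<nu>" using \<nu> by (rule prob_space_chi2)
  interpret B: prob_space "chi2 1" by (rule prob_space_chi2_1)
  interpret pair_prob_space "chi2 \<nu>" "chi2 1" ..
  have "(\<integral>\<^sup>+w. f w \<partial>chi2 (Suc \<nu>)) = (\<integral>\<^sup>+p. f (fst p + snd p) \<partial>(chi2 \<nu> \<Otimes>\<^sub>M chi2 1))"
    using prob_space_chi2_convolution_chi2[OF \<nu>] by (simp add: nn_integral_distr case_prod_unfold)
  also have "\<dots> = (\<integral>\<^sup>+w. \<integral>\<^sup>+t. f (w + t) \<partial>chi2 1 \<partial>chi2 \<nu>)"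
    by (subst B.nn_integral_fst[symmetric]) auto
  also have "\<dots> = (\<integral>\<^sup>+w. \<integral>\<^sup>+u. f (w + u\<^sup>2) \<partial>std_normal \<partial>chi2 \<nu>)"
    by (simp add: distr_std_normal_square[symmetric] nn_integral_distr del: One_nat_def)
  finally show ?thesis .
qed

section \<open>Sample mean and variance of normal samples\<close>

definition norm_sum :: "nat \<Rightarrow> (nat \<Rightarrow> real) \<Rightarrow> real" where
  "norm_sum n z = (\<Sum>l<n. z l) / sqrt (real n)"

text \<open>Equals the sum of squared deviations from the sample mean; in this form adding a sample is a plane rotation.\<close>

definition sq_dev :: "nat \<Rightarrow> (nat \<Rightarrow> real) \<Rightarrow> real" where
  "sq_dev n z = (\<Sum>l<n. (z l)\<^sup>2) - (norm_sum n z)\<^sup>2"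

lemma measurable_norm_sum [measurable (raw)]:
  assumes [measurable]: "\<And>l. l < n \<Longrightarrow> (\<lambda>w. z w l) \<in> borel_measurable M"
  shows "(\<lambda>w. norm_sum n (z w)) \<in> borel_measurable M"
  unfolding norm_sum_def by measurable

lemma measurable_sq_dev [measurable (raw)]:
  assumes [measurable]: "\<And>l. l < n \<Longrightarrow> (\<lambda>w. z w l) \<in> borel_measurable M"
  shows "(\<lambda>w. sq_dev n (z w)) \<in> borel_measurable M"
  unfolding sq_dev_def by measurable

lemma measurable_component_std_normal:
  "l \<in> I \<Longrightarrow> (\<lambda>z. z l) \<in> borel_measurable (PiM I (\<lambda>_. std_normal))"
  using measurable_component_singleton[of l I "\<lambda>_. std_normal"] by (simp cong: measurable_cong_sets)

lemma norm_sum_upd [simp]: "n \<le> i \<Longrightarrow> norm_sum n (z(i := y)) = norm_sum n z"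
  by (simp add: norm_sum_def)

lemma sq_dev_upd [simp]: "n \<le> i \<Longrightarrow> sq_dev n (z(i := y)) = sq_dev n z"
  by (simp add: sq_dev_def)

lemma norm_sum_restrict [simp]: "n \<le> k \<Longrightarrow> norm_sum n (restrict z {..<k}) = norm_sum n z"
  by (simp add: norm_sum_def)

lemma sq_dev_restrict [simp]: "n \<le> k \<Longrightarrow> sq_dev n (restrict z {..<k}) = sq_dev n z"
  by (simp add: sq_dev_def)

lemma norm_sum_Suc:
  assumes "1 \<le> n"
  shows "norm_sum (Suc n) (z(n := y))
    = sqrt (real n) / sqrt (real (Suc n)) * norm_sum n z + 1 / sqrt (real (Suc n)) * y"
  using assms by (simp add: norm_sum_def add_divide_distrib)

lemma sq_dev_Suc:
  assumes "1 \<le> n"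
  shows "sq_dev (Suc n) (z(n := y)) = sq_dev n z +
    (sqrt (real n) / sqrt (real (Suc n)) * y - 1 / sqrt (real (Suc n)) * norm_sum n z)\<^sup>2"
proof -
  define c s where "c = sqrt (real n) / sqrt (real (Suc n))" and "s = 1 / sqrt (real (Suc n))"
  have "c\<^sup>2 + s\<^sup>2 = 1"
    by (simp add: c_def s_def power_divide add_divide_distrib[symmetric])
  moreover have "(c * norm_sum n z + s * y)\<^sup>2 + (c * y - s * norm_sum n z)\<^sup>2
      = (c\<^sup>2 + s\<^sup>2) * ((norm_sum n z)\<^sup>2 + y\<^sup>2)"
    by (simp add: power2_eq_square algebra_simps)
  ultimately have "(c * norm_sum n z + s * y)\<^sup>2 + (c * y - s * norm_sum n z)\<^sup>2 = (norm_sum n z)\<^sup>2 + y\<^sup>2"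
    by simp
  then show ?thesis
    unfolding sq_dev_def norm_sum_Suc[OF assms] c_def[symmetric] s_def[symmetric]
    by simp
qed

interpretation std_normal_PiM: product_prob_space "\<lambda>_. std_normal" I for I :: "'i set"
  by unfold_locales

lemma nn_integral_sq_dev_norm_sum:
  fixes f :: "real \<times> real \<Rightarrow> ennreal"
  assumes "2 \<le> n" and f [measurable]: "f \<in> borel_measurable (borel \<Otimes>\<^sub>M borel)"
  shows "(\<integral>\<^sup>+z. f (sq_dev n z, norm_sum n z) \<partial>PiM {..<n} (\<lambda>_. std_normal))
    = (\<integral>\<^sup>+w. \<integral>\<^sup>+b. f (w, b) \<partial>std_normal \<partial>chi2 (n - 1))"
  using assms
proof (induction n arbitrary: f rule: dec_induct)
  define c s where "c n = sqrt (real n) / sqrt (real (Suc n))" and "s n = 1 / sqrt (real (Suc n))" for n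
  have cs: "(c n)\<^sup>2 + (s n)\<^sup>2 = 1" for n
    by (simp add: c_def s_def power_divide add_divide_distrib[symmetric])
  have c: "c n \<noteq> 0" if "1 \<le> n" for n using that by (simp add: c_def)
  have split: "(\<integral>\<^sup>+z. f (sq_dev (Suc n) z, norm_sum (Suc n) z) \<partial>PiM {..<Suc n} (\<lambda>_. std_normal))
    = (\<integral>\<^sup>+z. \<integral>\<^sup>+y. f (sq_dev n z + (c n * y - s n * norm_sum n z)\<^sup>2, c n * norm_sum n z + s n * y) \<partial>std_normal
        \<partial>PiM {..<n} (\<lambda>_. std_normal))"
    if [measurable]: "f \<in> borel_measurable (borel \<Otimes>\<^sub>M borel)" and "1 \<le> n" for n and f :: "real \<times> real \<Rightarrow> ennreal"
    unfolding lessThan_Suc using that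
    by (subst std_normal_PiM.product_nn_integral_insert)
      (auto simp: norm_sum_Suc sq_dev_Suc c_def s_def intro!: measurable_compose[OF _ that(1)] measurable_Pair measurable_sq_dev measurable_norm_sum measurable_component_std_normal)
  {
    case base
    note [measurable] = base
    have "(\<integral>\<^sup>+z. f (sq_dev 2 z, norm_sum 2 z) \<partial>PiM {..<2} (\<lambda>_. std_normal))
      = (\<integral>\<^sup>+z. \<integral>\<^sup>+y. f ((c 1 * y - s 1 * z 0)\<^sup>2, c 1 * z 0 + s 1 * y) \<partial>std_normal
        \<partial>PiM {0::nat} (\<lambda>_. std_normal))"
      using split[OF base, of 1] by (simp add: sq_dev_def norm_sum_def numeral_2_eq_2 lessThan_Suc)
    also have "\<dots> = (\<integral>\<^sup>+b. \<integral>\<^sup>+y. f ((c 1 * y - s 1 * b)\<^sup>2, c 1 * b + s 1 * y) \<partial>std_normal \<partial>std_normal)"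
      by (subst std_normal_PiM.product_nn_integral_singleton) auto
    also have "\<dots> = (\<integral>\<^sup>+b. \<integral>\<^sup>+y. f (y\<^sup>2, b) \<partial>std_normal \<partial>std_normal)"
      using nn_integral_std_normal_rotate[of "\<lambda>(u, v). f (v\<^sup>2, u)", OF _ c cs, of 1] by simp
    also have "\<dots> = (\<integral>\<^sup>+y. \<integral>\<^sup>+b. f (y\<^sup>2, b) \<partial>std_normal \<partial>std_normal)"
      by (rule pair_sigma_finite.Fubini') (auto simp: pair_sigma_finite_def std_normal.sigma_finite_measure_axioms)
    also have "\<dots> = (\<integral>\<^sup>+w. \<integral>\<^sup>+b. f (w, b) \<partial>std_normal \<partial>chi2 (2 - 1))"
    proof -
      have "chi2 (2 - 1) = distr std_normal borel (\<lambda>u. u\<^sup>2)"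
        by (simp add: distr_std_normal_square)
      then show ?thesis by (simp only:) (subst nn_integral_distr, auto)
    qed
    finally show ?case .
  next
    case (step n)
    note [measurable] = step.prems
    have "(\<integral>\<^sup>+z. f (sq_dev (Suc n) z, norm_sum (Suc n) z) \<partial>PiM {..<Suc n} (\<lambda>_. std_normal))
      = (\<integral>\<^sup>+z. \<integral>\<^sup>+y. f (sq_dev n z + (c n * y - s n * norm_sum n z)\<^sup>2, c n * norm_sum n z + s n * y) \<partial>std_normal
        \<partial>PiM {..<n} (\<lambda>_. std_normal))"
      using step by (intro split) auto
    also have "\<dots> = (\<integral>\<^sup>+w. \<integral>\<^sup>+b. \<integral>\<^sup>+y. f (w + (c n * y - s n * b)\<^sup>2, c n * b + s n * y) \<partial>std_normal \<partial>std_normal \<partial>chi2 (n - 1))"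
      using step.IH[of "\<lambda>(w, b). \<integral>\<^sup>+y. f (w + (c n * y - s n * b)\<^sup>2, c n * b + s n * y) \<partial>std_normal"] by simp
    also have "\<dots> = (\<integral>\<^sup>+w. \<integral>\<^sup>+b. \<integral>\<^sup>+y. f (w + y\<^sup>2, b) \<partial>std_normal \<partial>std_normal \<partial>chi2 (n - 1))"
    proof (rule nn_integral_cong)
      fix w :: real
      show "(\<integral>\<^sup>+b. \<integral>\<^sup>+y. f (w + (c n * y - s n * b)\<^sup>2, c n * b + s n * y) \<partial>std_normal \<partial>std_normal)
        = (\<integral>\<^sup>+b. \<integral>\<^sup>+y. f (w + y\<^sup>2, b) \<partial>std_normal \<partial>std_normal)"
        using nn_integral_std_normal_rotate[of "\<lambda>(u, v). f (w + v\<^sup>2, u)" "c n" "s n", OF _ _ cs] c[of n] step.hyps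
        by simp
    qed
    also have "\<dots> = (\<integral>\<^sup>+w. \<integral>\<^sup>+y. \<integral>\<^sup>+b. f (w + y\<^sup>2, b) \<partial>std_normal \<partial>std_normal \<partial>chi2 (n - 1))"
      by (intro nn_integral_cong pair_sigma_finite.Fubini') (auto simp: pair_sigma_finite_def std_normal.sigma_finite_measure_axioms)
    also have "\<dots> = (\<integral>\<^sup>+w. \<integral>\<^sup>+b. f (w, b) \<partial>std_normal \<partial>chi2 (Suc n - 1))"
      using nn_integral_chi2_Suc[of "n - 1" "\<lambda>w. \<integral>\<^sup>+b. f (w, b) \<partial>std_normal"] step by simp
    finally show ?case .
  }
qed

lemma nn_integral_sq_dev_norm_sum_le:
  fixes f :: "real \<times> real \<Rightarrow> ennreal"
  assumes "2 \<le> n0" "n0 \<le> n" and f [measurable]: "f \<in> borel_measurable (borel \<Otimes>\<^sub>M borel)"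
  shows "(\<integral>\<^sup>+z. f (sq_dev n0 z, norm_sum n z) \<partial>PiM {..<n} (\<lambda>_. std_normal))
    = (\<integral>\<^sup>+w. \<integral>\<^sup>+b. f (w, b) \<partial>std_normal \<partial>chi2 (n0 - 1))"
  using assms(2,3)
proof (induction n arbitrary: f rule: dec_induct)
  case base
  then show ?case by (rule nn_integral_sq_dev_norm_sum[OF assms(1)])
next
  case (step n)
  note [measurable] = step.prems
  define c s where "c = sqrt (real n) / sqrt (real (Suc n))" and "s = 1 / sqrt (real (Suc n))"
  have cs: "c\<^sup>2 + s\<^sup>2 = 1"
    by (simp add: c_def s_def power_divide add_divide_distrib[symmetric])
  have "(\<integral>\<^sup>+z. f (sq_dev n0 z, norm_sum (Suc n) z) \<partial>PiM {..<Suc n} (\<lambda>_. std_normal))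
    = (\<integral>\<^sup>+z. \<integral>\<^sup>+y. f (sq_dev n0 z, c * norm_sum n z + s * y) \<partial>std_normal \<partial>PiM {..<n} (\<lambda>_. std_normal))"
    unfolding lessThan_Suc using step assms(1)
    by (subst std_normal_PiM.product_nn_integral_insert)
      (auto simp: norm_sum_Suc c_def s_def intro!: measurable_compose[OF _ step.prems] measurable_Pair measurable_sq_dev measurable_norm_sum measurable_component_std_normal)
  also have "\<dots> = (\<integral>\<^sup>+w. \<integral>\<^sup>+b. \<integral>\<^sup>+y. f (w, c * b + s * y) \<partial>std_normal \<partial>std_normal \<partial>chi2 (n0 - 1))"
    using step.IH[of "\<lambda>(w, b). \<integral>\<^sup>+y. f (w, c * b + s * y) \<partial>std_normal"] by simp
  also have "\<dots> = (\<integral>\<^sup>+w. \<integral>\<^sup>+b. f (w, b) \<partial>std_normal \<partial>chi2 (n0 - 1))"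
    by (subst nn_integral_std_normal_add) (auto simp: cs)
  finally show ?case .
qed

lemma (in prob_space) distr_sq_dev_norm_sum:
  fixes Z :: "nat \<Rightarrow> 'a \<Rightarrow> real" and N :: "real \<Rightarrow> nat"
  assumes indep: "indep_vars (\<lambda>_. borel) Z UNIV"
    and law: "\<And>l. distr M borel (Z l) = std_normal"
    and n0: "2 \<le> n0"
    and N [measurable]: "N \<in> borel \<rightarrow>\<^sub>M count_space UNIV"
    and N_ge: "\<And>w. n0 \<le> N w"
  shows "distr M (borel \<Otimes>\<^sub>M borel)
      (\<lambda>\<omega>. (sq_dev n0 (\<lambda>l. Z l \<omega>), norm_sum (N (sq_dev n0 (\<lambda>l. Z l \<omega>))) (\<lambda>l. Z l \<omega>)))
    = chi2 (n0 - 1) \<Otimes>\<^sub>M std_normal" (is "distr M _ ?T = ?R")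
proof (rule measure_eqI)
  have [measurable]: "Z l \<in> borel_measurable M" for l
    using indep by (simp add: indep_vars_def)
  have [measurable]: "N \<in> borel_measurable borel"
    using measurable_compose[OF N, of "\<lambda>n. n" borel] by simp
  let ?W = "\<lambda>\<omega>. sq_dev n0 (\<lambda>l. Z l \<omega>)"
  have T [measurable]: "?T \<in> M \<rightarrow>\<^sub>M borel \<Otimes>\<^sub>M borel"
    by (intro measurable_Pair measurable_compose_countable[where g="\<lambda>\<omega>. N (?W \<omega>)" and f="\<lambda>n \<omega>. norm_sum n (\<lambda>l. Z l \<omega>)"])
      measurable
  interpret chi2: prob_space "chi2 (n0 - 1)" using n0 by (intro prob_space_chi2) simp
  fix A assume "A \<in> sets (distr M (borel \<Otimes>\<^sub>M borel) ?T)"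
  then have A [measurable]: "A \<in> sets (borel \<Otimes>\<^sub>M borel)" by simp
  let ?f = "\<lambda>n (w, b). indicator A (w, b) * indicator {n} (N w) :: ennreal"
  have single: "(\<Sum>n. ?f n (w, b')) = indicator A (w, b')" for w b'
  proof -
    have "(\<lambda>n. ?f n (w, b')) = (\<lambda>n. if n = N w then indicator A (w, b') else 0)"
      by (auto simp: fun_eq_iff)
    then show ?thesis
      using sums_single[of "N w" "\<lambda>_. indicator A (w, b') :: ennreal"] by (simp add: sums_iff)
  qed
  have *: "(\<integral>\<^sup>+\<omega>. ?f n (?W \<omega>, norm_sum n (\<lambda>l. Z l \<omega>)) \<partial>M)
      = (\<integral>\<^sup>+w. \<integral>\<^sup>+b. ?f n (w, b) \<partial>std_normal \<partial>chi2 (n0 - 1))" for n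
  proof (cases "n0 \<le> n")
    case False
    then have "?f n p = 0" for p using N_ge[of "fst p"] by (auto simp: indicator_def split: prod.split)
    then show ?thesis by simp
  next
    case True
    have D: "distr M (PiM {..<n} (\<lambda>_. borel)) (\<lambda>\<omega>. \<lambda>l\<in>{..<n}. Z l \<omega>) = PiM {..<n} (\<lambda>_. std_normal)"
      using indep_vars_iff_distr_eq_PiM'[of "{..<n}" Z "\<lambda>_. borel"] True n0
        indep_vars_subset[OF indep, of "{..<n}"]
      by (simp add: law lessThan_empty_iff)
    have fm: "?f n \<in> borel_measurable (borel \<Otimes>\<^sub>M borel)" by measurable
    have m: "sq_dev n0 \<in> borel_measurable (PiM {..<n} (\<lambda>_. borel))"
      "norm_sum n \<in> borel_measurable (PiM {..<n} (\<lambda>_. borel))"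
      using True by (auto intro!: measurable_sq_dev[where z="\<lambda>z. z"] measurable_norm_sum[where z="\<lambda>z. z"])
    have "(\<integral>\<^sup>+z. ?f n (sq_dev n0 z, norm_sum n z) \<partial>PiM {..<n} (\<lambda>_. std_normal))
      = (\<integral>\<^sup>+\<omega>. ?f n (sq_dev n0 (\<lambda>l\<in>{..<n}. Z l \<omega>), norm_sum n (\<lambda>l\<in>{..<n}. Z l \<omega>)) \<partial>M)"
      unfolding D[symmetric]
      by (subst nn_integral_distr)
        (simp_all add: measurable_compose[OF measurable_Pair[OF m] fm, unfolded prod.case] del: split_paired_All)
    then show ?thesis
      using True nn_integral_sq_dev_norm_sum_le[OF n0 True, of "?f n"] by simp
  qed
  have "emeasure (distr M (borel \<Otimes>\<^sub>M borel) ?T) A = (\<integral>\<^sup>+\<omega>. indicator A (?T \<omega>) \<partial>M)"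
    using nn_integral_distr[OF T, of "indicator A"] by simp
  also have "\<dots> = (\<integral>\<^sup>+\<omega>. (\<Sum>n. ?f n (?W \<omega>, norm_sum n (\<lambda>l. Z l \<omega>))) \<partial>M)"
  proof (rule nn_integral_cong)
    fix \<omega>
    have "?f n (?W \<omega>, norm_sum n (\<lambda>l. Z l \<omega>)) = ?f n (?T \<omega>)" for n
      by (auto simp: indicator_def)
    then show "indicator A (?T \<omega>) = (\<Sum>n. ?f n (?W \<omega>, norm_sum n (\<lambda>l. Z l \<omega>)))"
      by (simp only: single)
  qed
  also have "\<dots> = (\<Sum>n. \<integral>\<^sup>+\<omega>. ?f n (?W \<omega>, norm_sum n (\<lambda>l. Z l \<omega>)) \<partial>M)"
    by (rule nn_integral_suminf) measurable
  also have "\<dots> = (\<Sum>n. \<integral>\<^sup>+w. \<integral>\<^sup>+b. ?f n (w, b) \<partial>std_normal \<partial>chi2 (n0 - 1))"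
    by (simp only: *)
  also have "\<dots> = (\<integral>\<^sup>+w. \<integral>\<^sup>+b. (\<Sum>n. ?f n (w, b)) \<partial>std_normal \<partial>chi2 (n0 - 1))"
    by (simp add: nn_integral_suminf del: ennreal_suminf_cmult)
  also have "\<dots> = emeasure ?R A"
    unfolding single by (subst std_normal.emeasure_pair_measure) (simp_all cong: sets_pair_measure_cong)
  finally show "emeasure (distr M (borel \<Otimes>\<^sub>M borel) ?T) A = emeasure ?R A" .
qed (simp cong: sets_pair_measure_cong)

lemma fd_first_var_affine:
  assumes "2 \<le> n0"
  shows "fd_first_var n0 (\<lambda>l. \<mu> + \<sigma> * z l) = \<sigma>\<^sup>2 * sq_dev n0 z / (real n0 - 1)"
proof -
  define S where "S = (\<Sum>l<n0. z l)"
  have n: "real n0 > 0" using assms by simp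
  have "fd_first_mean n0 (\<lambda>l. \<mu> + \<sigma> * z l) = \<mu> + \<sigma> * (S / n0)"
    using n by (simp add: fd_first_mean_def sum.distrib sum_distrib_left[symmetric] S_def field_simps)
  then have "(\<Sum>l<n0. (\<mu> + \<sigma> * z l - fd_first_mean n0 (\<lambda>l. \<mu> + \<sigma> * z l))\<^sup>2)
      = (\<Sum>l<n0. \<sigma>\<^sup>2 * ((z l)\<^sup>2 - 2 * (S / n0) * z l + (S / n0)\<^sup>2))"
    by (simp add: power2_eq_square algebra_simps)
  also have "\<dots> = \<sigma>\<^sup>2 * ((\<Sum>l<n0. (z l)\<^sup>2) - 2 * (S / n0) * S + n0 * (S / n0)\<^sup>2)"
    by (simp only: sum_distrib_left[symmetric] sum.distrib sum_subtractf sum_constant card_lessThan S_def[symmetric])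
  also have "\<dots> = \<sigma>\<^sup>2 * sq_dev n0 z"
    using n by (simp add: sq_dev_def norm_sum_def S_def[symmetric] power_divide power2_eq_square)
  finally show ?thesis by (simp add: fd_first_var_def)
qed

lemma fd_mean_affine:
  assumes "2 \<le> n0" and N: "N = fd_N h \<delta> n0 (\<lambda>l. \<mu> + \<sigma> * z l)"
  shows "fd_mean h \<delta> n0 (\<lambda>l. \<mu> + \<sigma> * z l) = \<mu> + \<sigma> / sqrt N * norm_sum N z"
proof -
  have "real N > 0" using assms(1) unfolding N fd_N_def by simp
  then show ?thesis
    by (simp add: fd_mean_def N[symmetric] norm_sum_def sum.distrib sum_distrib_left[symmetric] field_simps)
qed

section \<open>Mixtures of normals and the minimum of chi-squared variables\<close>

lemma nn_integral_PiM_weighted_sum: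
  fixes b :: "'j \<Rightarrow> real \<Rightarrow> real" and f :: "('j \<Rightarrow> real) \<times> real \<Rightarrow> ennreal"
  assumes J: "finite J" and C: "prob_space C" and C_sets [measurable_cong, simp]: "sets C = sets borel"
    and b [measurable]: "\<And>j. b j \<in> borel_measurable borel"
    and f: "f \<in> borel_measurable (PiM J (\<lambda>_. borel) \<Otimes>\<^sub>M borel)"
  shows "(\<integral>\<^sup>+p. f (\<lambda>j\<in>J. fst (p j), \<Sum>j\<in>J. b j (fst (p j)) * snd (p j)) \<partial>PiM J (\<lambda>_. C \<Otimes>\<^sub>M std_normal))
    = (\<integral>\<^sup>+\<xi>. \<integral>\<^sup>+q. f (\<xi>, sqrt (\<Sum>j\<in>J. (b j (\<xi> j))\<^sup>2) * q) \<partial>std_normal \<partial>PiM J (\<lambda>_. C))"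
  using J f
proof (induction J arbitrary: f rule: finite_induct)
  interpret C: prob_space C by fact
  interpret Cn: pair_prob_space C std_normal ..
  interpret P: product_prob_space "\<lambda>_::'j. C \<Otimes>\<^sub>M std_normal" by unfold_locales
  interpret Q: product_prob_space "\<lambda>_::'j. C" by unfold_locales
  {
    case empty
    then show ?case
      by (simp add: PiM_empty nn_integral_count_space_finite)
  next
    case (insert i J)
    note [simp] = insert.hyps and [measurable] = insert.prems
    let ?V = "\<lambda>\<xi>. \<Sum>j\<in>J. (b j (\<xi> j))\<^sup>2"
    define g where "g = (\<lambda>(\<xi>, S). \<integral>\<^sup>+y. f (\<xi>(i := fst y), S + b i (fst y) * snd y) \<partial>(C \<Otimes>\<^sub>M std_normal))"
    have [measurable]: "g \<in> borel_measurable (PiM J (\<lambda>_. borel) \<Otimes>\<^sub>M borel)"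
      unfolding g_def by measurable
    have "(\<integral>\<^sup>+p. f (\<lambda>j\<in>insert i J. fst (p j), \<Sum>j\<in>insert i J. b j (fst (p j)) * snd (p j))
          \<partial>PiM (insert i J) (\<lambda>_. C \<Otimes>\<^sub>M std_normal))
      = (\<integral>\<^sup>+p. \<integral>\<^sup>+y. f (\<lambda>j\<in>insert i J. fst ((p(i := y)) j), \<Sum>j\<in>insert i J. b j (fst ((p(i := y)) j)) * snd ((p(i := y)) j))
          \<partial>(C \<Otimes>\<^sub>M std_normal) \<partial>PiM J (\<lambda>_. C \<Otimes>\<^sub>M std_normal))"
      by (subst P.product_nn_integral_insert) (auto cong: measurable_cong_sets)
    also have "\<dots> = (\<integral>\<^sup>+p. g (\<lambda>j\<in>J. fst (p j), \<Sum>j\<in>J. b j (fst (p j)) * snd (p j)) \<partial>PiM J (\<lambda>_. C \<Otimes>\<^sub>M std_normal))"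
    proof (rule nn_integral_cong)
      fix p :: "'j \<Rightarrow> real \<times> real"
      have "(\<lambda>j\<in>insert i J. fst ((p(i := y)) j)) = (\<lambda>j\<in>J. fst (p j))(i := fst y)" for y
        by (auto simp: fun_eq_iff)
      moreover have "(\<Sum>j\<in>insert i J. b j (fst ((p(i := y)) j)) * snd ((p(i := y)) j))
          = (\<Sum>j\<in>J. b j (fst (p j)) * snd (p j)) + b i (fst y) * snd y" for y
        by (subst sum.insert) (auto intro!: sum.cong)
      ultimately show "(\<integral>\<^sup>+y. f (\<lambda>j\<in>insert i J. fst ((p(i := y)) j), \<Sum>j\<in>insert i J. b j (fst ((p(i := y)) j)) * snd ((p(i := y)) j))
          \<partial>(C \<Otimes>\<^sub>M std_normal)) = g (\<lambda>j\<in>J. fst (p j), \<Sum>j\<in>J. b j (fst (p j)) * snd (p j))"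
        by (simp only: g_def prod.case)
    qed
    also have "\<dots> = (\<integral>\<^sup>+\<xi>. \<integral>\<^sup>+q. g (\<xi>, sqrt (?V \<xi>) * q) \<partial>std_normal \<partial>PiM J (\<lambda>_. C))"
      by (rule insert.IH) measurable
    also have "\<dots> = (\<integral>\<^sup>+\<xi>. \<integral>\<^sup>+x. \<integral>\<^sup>+q. f (\<xi>(i := x), sqrt (?V \<xi> + (b i x)\<^sup>2) * q) \<partial>std_normal \<partial>C \<partial>PiM J (\<lambda>_. C))"
    proof (rule nn_integral_cong)
      fix \<xi> :: "'j \<Rightarrow> real" assume "\<xi> \<in> space (PiM J (\<lambda>_. C))"
      then have \<xi>: "\<xi> \<in> space (PiM J (\<lambda>_. borel))"
        by (simp add: space_PiM sets_eq_imp_space_eq[OF C_sets])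
      have fm [measurable]: "(\<lambda>(x, S). f (\<xi>(i := x), S)) \<in> borel_measurable (borel \<Otimes>\<^sub>M borel)"
        using \<xi> by measurable
      have "(\<integral>\<^sup>+q. g (\<xi>, sqrt (?V \<xi>) * q) \<partial>std_normal)
        = (\<integral>\<^sup>+q. \<integral>\<^sup>+x. \<integral>\<^sup>+r. (\<lambda>(x, S). f (\<xi>(i := x), S)) (x, sqrt (?V \<xi>) * q + b i x * r) \<partial>std_normal \<partial>C \<partial>std_normal)"
        unfolding g_def prod.case
        using measurable_compose[OF _ fm]
        by (intro nn_integral_cong) (subst std_normal.nn_integral_fst[symmetric], simp_all)
      also have "\<dots> = (\<integral>\<^sup>+x. \<integral>\<^sup>+q. \<integral>\<^sup>+r. (\<lambda>(x, S). f (\<xi>(i := x), S)) (x, sqrt (?V \<xi>) * q + b i x * r) \<partial>std_normal \<partial>std_normal \<partial>C)"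
        by (rule pair_sigma_finite.Fubini')
          (auto simp: pair_sigma_finite_def std_normal.sigma_finite_measure_axioms C.sigma_finite_measure_axioms)
      also have "\<dots> = (\<integral>\<^sup>+x. \<integral>\<^sup>+q. (\<lambda>(x, S). f (\<xi>(i := x), S)) (x, sqrt (?V \<xi> + (b i x)\<^sup>2) * q) \<partial>std_normal \<partial>C)"
      proof (rule nn_integral_cong)
        fix x
        have "(\<lambda>S. (\<lambda>(x, S). f (\<xi>(i := x), S)) (x, S)) \<in> borel_measurable borel" by measurable
        from nn_integral_std_normal_add[OF this, of "sqrt (?V \<xi>)" "b i x"]
        show "(\<integral>\<^sup>+q. \<integral>\<^sup>+r. (\<lambda>(x, S). f (\<xi>(i := x), S)) (x, sqrt (?V \<xi>) * q + b i x * r) \<partial>std_normal \<partial>std_normal)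
          = (\<integral>\<^sup>+q. (\<lambda>(x, S). f (\<xi>(i := x), S)) (x, sqrt (?V \<xi> + (b i x)\<^sup>2) * q) \<partial>std_normal)"
          by (simp add: sum_nonneg)
      qed
      finally show "(\<integral>\<^sup>+q. g (\<xi>, sqrt (?V \<xi>) * q) \<partial>std_normal)
        = (\<integral>\<^sup>+x. \<integral>\<^sup>+q. f (\<xi>(i := x), sqrt (?V \<xi> + (b i x)\<^sup>2) * q) \<partial>std_normal \<partial>C)" by simp
    qed
    also have "\<dots> = (\<integral>\<^sup>+\<xi>. \<integral>\<^sup>+x. \<integral>\<^sup>+q. f (\<xi>(i := x), sqrt (\<Sum>j\<in>insert i J. (b j ((\<xi>(i := x)) j))\<^sup>2) * q)
        \<partial>std_normal \<partial>C \<partial>PiM J (\<lambda>_. C))"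
    proof -
      have "(\<Sum>j\<in>insert i J. (b j ((\<xi>(i := x)) j))\<^sup>2) = ?V \<xi> + (b i x)\<^sup>2" for \<xi> x
        by (subst sum.insert) (auto intro!: sum.cong)
      then show ?thesis by (simp only:)
    qed
    also have "\<dots> = (\<integral>\<^sup>+\<xi>. \<integral>\<^sup>+q. f (\<xi>, sqrt (\<Sum>j\<in>insert i J. (b j (\<xi> j))\<^sup>2) * q) \<partial>std_normal \<partial>PiM (insert i J) (\<lambda>_. C))"
      by (subst Q.product_nn_integral_insert) auto
    finally show ?case .
  }
qed

lemma emeasure_chi2_eq_cdf:
  assumes "1 \<le> \<nu>"
  shows "emeasure (chi2 \<nu>) {..s} = ennreal (chi2_cdf \<nu> s)"
proof -
  interpret prob_space "chi2 \<nu>" using assms by (rule prob_space_chi2)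
  have eq: "emeasure (chi2 \<nu>) {..s} = (\<integral>\<^sup>+u. ennreal (indicator {0..s} u *\<^sub>R chi2_pdf \<nu> u) \<partial>lborel)"
    unfolding chi2_def by (subst emeasure_density) (auto intro!: nn_integral_cong simp: indicator_def chi2_pdf_def)
  have "integrable lborel (\<lambda>u. indicator {0..s} u *\<^sub>R chi2_pdf \<nu> u)"
    using emeasure_finite[of "{..s}"] unfolding eq
    by (intro integrableI_nonneg) (auto simp: less_top)
  then show ?thesis
    unfolding eq chi2_cdf_def set_lebesgue_integral_def by (subst nn_integral_eq_integral) auto
qed

lemma chi2_cdf_eq_measure: "1 \<le> \<nu> \<Longrightarrow> chi2_cdf \<nu> s = measure (chi2 \<nu>) {..s}"
  using emeasure_chi2_eq_cdf[of \<nu> s]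
  by (simp add: measure_def chi2_cdf_def set_lebesgue_integral_def Bochner_Integration.integral_nonneg)

lemma chi2_cdf_le_1: "1 \<le> \<nu> \<Longrightarrow> chi2_cdf \<nu> s \<le> 1"
  by (simp add: chi2_cdf_eq_measure prob_space.prob_le_1[OF prob_space_chi2])

lemma borel_measurable_chi2_cdf: "1 \<le> \<nu> \<Longrightarrow> chi2_cdf \<nu> \<in> borel_measurable borel"
proof (rule borel_measurable_mono)
  assume \<nu>: "1 \<le> \<nu>"
  interpret prob_space "chi2 \<nu>" using \<nu> by (rule prob_space_chi2)
  show "mono (chi2_cdf \<nu>)"
    by (intro monoI) (auto simp: chi2_cdf_eq_measure[OF \<nu>] intro!: finite_measure_mono)
qed

lemma emeasure_chi2_greaterThan:
  assumes "1 \<le> \<nu>"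
  shows "emeasure (chi2 \<nu>) {s<..} = ennreal (1 - chi2_cdf \<nu> s)"
proof -
  interpret prob_space "chi2 \<nu>" using assms by (rule prob_space_chi2)
  have "{s<..} = space (chi2 \<nu>) - {..s}" by auto
  then have "measure (chi2 \<nu>) {s<..} = 1 - measure (chi2 \<nu>) {..s}"
    by (simp only: prob_compl) (subst prob_compl, auto)
  then show ?thesis
    by (simp add: emeasure_eq_measure chi2_cdf_eq_measure[OF assms])
qed

lemma emeasure_chi2_atLeast:
  assumes "1 \<le> \<nu>"
  shows "emeasure (chi2 \<nu>) {s..} = ennreal (1 - chi2_cdf \<nu> s)"
proof -
  have "emeasure (chi2 \<nu>) {s..} = emeasure (chi2 \<nu>) {s<..}"
    unfolding chi2_def
    by (subst (1 2) emeasure_density) (auto intro!: nn_integral_cong_AE eventually_mono[OF AE_lborel_singleton[of s]] simp: indicator_def)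
  then show ?thesis by (simp add: emeasure_chi2_greaterThan[OF assms])
qed

lemma chi2_min_pdf_nonneg: "1 \<le> \<nu> \<Longrightarrow> 0 \<le> chi2_min_pdf m \<nu> s"
  using chi2_cdf_le_1[of \<nu> s] by (simp add: chi2_min_pdf_def)

lemma borel_measurable_chi2_min_pdf: "1 \<le> \<nu> \<Longrightarrow> chi2_min_pdf m \<nu> \<in> borel_measurable borel"
  unfolding chi2_min_pdf_def[abs_def] using borel_measurable_chi2_cdf[measurable] by measurable

lemma nn_integral_chi2:
  assumes [measurable]: "f \<in> borel_measurable borel"
  shows "(\<integral>\<^sup>+x. f x \<partial>chi2 \<nu>) = (\<integral>\<^sup>+x. ennreal (chi2_pdf \<nu> x) * f x \<partial>lborel)"
  unfolding chi2_def by (subst nn_integral_density) auto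

text \<open>Induction on the index set: conditioning on which of the old minimum and the new variable is smaller avoids differentiating the distribution function.\<close>

lemma nn_integral_PiM_chi2_Min:
  fixes f :: "real \<Rightarrow> ennreal"
  assumes "finite J" "J \<noteq> {}" and \<nu>: "1 \<le> \<nu>" and "f \<in> borel_measurable borel"
  shows "(\<integral>\<^sup>+\<xi>. f (Min (\<xi> ` J)) \<partial>PiM J (\<lambda>_::'j. chi2 \<nu>)) = (\<integral>\<^sup>+s. ennreal (chi2_min_pdf (card J) \<nu> s) * f s \<partial>lborel)"
  using assms(1,2,4)
proof (induction J arbitrary: f rule: finite_ne_induct)
  interpret chi2: prob_space "chi2 \<nu>" using \<nu> by (rule prob_space_chi2)
  interpret Q: product_prob_space "\<lambda>_::'j. chi2 \<nu>" by unfold_locales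
  {
    case (singleton x)
    then show ?case
      by (simp add: Q.product_nn_integral_singleton nn_integral_chi2 chi2_min_pdf_def)
  next
    case (insert i J)
    note [measurable] = insert.prems and [simp] = insert.hyps
    let ?g = "\<lambda>s. ennreal (chi2_min_pdf (card J) \<nu> s)"
    have [measurable]: "Measurable.pred (borel \<Otimes>\<^sub>M borel) (\<lambda>x::real \<times> real. snd x \<in> {..<fst x})"
      "Measurable.pred (borel \<Otimes>\<^sub>M borel) (\<lambda>x::real \<times> real. fst x \<in> {..<snd x})"
      unfolding lessThan_iff by measurable
    note [measurable] = borel_measurable_chi2_cdf[OF \<nu>] borel_measurable_chi2_min_pdf[OF \<nu>]
    have tail: "(\<integral>\<^sup>+s. ?g s * indicator {x<..} s \<partial>lborel) = ennreal ((1 - chi2_cdf \<nu> x) ^ card J)" for x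
    proof -
      have "(\<integral>\<^sup>+s. ?g s * indicator {x<..} s \<partial>lborel) = (\<integral>\<^sup>+\<xi>. indicator {x<..} (Min (\<xi> ` J)) \<partial>PiM J (\<lambda>_. chi2 \<nu>))"
        by (rule insert.IH[symmetric]) measurable
      also have "\<dots> = (\<integral>\<^sup>+\<xi>. indicator (Pi\<^sub>E J (\<lambda>_. {x<..})) \<xi> \<partial>PiM J (\<lambda>_. chi2 \<nu>))"
        by (intro nn_integral_cong) (auto simp: indicator_def space_PiM PiE_iff)
      also have "\<dots> = (\<Prod>j\<in>J. emeasure (chi2 \<nu>) {x<..})"
        by (subst nn_integral_indicator) (auto intro!: sets_PiM_I_finite simp: Q.emeasure_PiM)
      also have "\<dots> = ennreal ((1 - chi2_cdf \<nu> x) ^ card J)"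
        using chi2_cdf_le_1[OF \<nu>, of x] by (simp add: emeasure_chi2_greaterThan[OF \<nu>] ennreal_power)
      finally show ?thesis .
    qed
    have "(\<integral>\<^sup>+\<xi>. f (Min (\<xi> ` insert i J)) \<partial>PiM (insert i J) (\<lambda>_. chi2 \<nu>))
      = (\<integral>\<^sup>+\<xi>. \<integral>\<^sup>+x. f (Min ((\<xi>(i := x)) ` insert i J)) \<partial>chi2 \<nu> \<partial>PiM J (\<lambda>_. chi2 \<nu>))"
      by (subst Q.product_nn_integral_insert) (auto intro!: measurable_compose[OF _ insert.prems] borel_measurable_Min)
    also have "\<dots> = (\<integral>\<^sup>+\<xi>. \<integral>\<^sup>+x. f (min (Min (\<xi> ` J)) x) \<partial>chi2 \<nu> \<partial>PiM J (\<lambda>_. chi2 \<nu>))"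
    proof -
      have "(\<xi>(i := x)) ` J = \<xi> ` J" for \<xi> and x :: real by (auto simp: image_iff)
      then have "Min ((\<xi>(i := x)) ` insert i J) = min (Min (\<xi> ` J)) x" for \<xi> and x :: real
        by (simp add: min.commute)
      then show ?thesis by simp
    qed
    also have "\<dots> = (\<integral>\<^sup>+s. ?g s * (\<integral>\<^sup>+x. f (min s x) \<partial>chi2 \<nu>) \<partial>lborel)"
      by (rule insert.IH) measurable
    also have "\<dots> = (\<integral>\<^sup>+s. ?g s * (f s * emeasure (chi2 \<nu>) {s..} + (\<integral>\<^sup>+x. f x * indicator {..<s} x \<partial>chi2 \<nu>)) \<partial>lborel)"
    proof (rule nn_integral_cong)
      fix s :: real
      have "(\<integral>\<^sup>+x. f (min s x) \<partial>chi2 \<nu>) = (\<integral>\<^sup>+x. f s * indicator {s..} x + f x * indicator {..<s} x \<partial>chi2 \<nu>)"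
        by (intro nn_integral_cong) (auto simp: indicator_def min_def)
      then show "?g s * (\<integral>\<^sup>+x. f (min s x) \<partial>chi2 \<nu>)
          = ?g s * (f s * emeasure (chi2 \<nu>) {s..} + (\<integral>\<^sup>+x. f x * indicator {..<s} x \<partial>chi2 \<nu>))"
        by (simp add: nn_integral_add nn_integral_cmult)
    qed
    also have "\<dots> = (\<integral>\<^sup>+s. ?g s * (ennreal (1 - chi2_cdf \<nu> s) * f s) + (\<integral>\<^sup>+x. ?g s * (f x * indicator {..<s} x) \<partial>chi2 \<nu>) \<partial>lborel)"
      by (simp add: emeasure_chi2_atLeast[OF \<nu>] distrib_left nn_integral_cmult mult.commute[of "f _" "ennreal _"])
    also have "\<dots> = (\<integral>\<^sup>+s. ?g s * (ennreal (1 - chi2_cdf \<nu> s) * f s) \<partial>lborel)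
        + (\<integral>\<^sup>+s. \<integral>\<^sup>+x. ?g s * (f x * indicator {..<s} x) \<partial>chi2 \<nu> \<partial>lborel)"
      by (rule nn_integral_add) measurable
    also have "(\<integral>\<^sup>+s. \<integral>\<^sup>+x. ?g s * (f x * indicator {..<s} x) \<partial>chi2 \<nu> \<partial>lborel)
        = (\<integral>\<^sup>+x. \<integral>\<^sup>+s. ?g s * (f x * indicator {..<s} x) \<partial>lborel \<partial>chi2 \<nu>)"
      by (rule pair_sigma_finite.Fubini')
        (auto simp: pair_sigma_finite_def chi2.sigma_finite_measure_axioms sigma_finite_lborel)
    also have "\<dots> = (\<integral>\<^sup>+x. f x * (\<integral>\<^sup>+s. ?g s * indicator {x<..} s \<partial>lborel) \<partial>chi2 \<nu>)"
      by (subst nn_integral_cmult[symmetric]) (auto intro!: nn_integral_cong simp: indicator_def mult.commute)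
    also have "\<dots> = (\<integral>\<^sup>+x. ennreal (chi2_pdf \<nu> x) * (f x * ennreal ((1 - chi2_cdf \<nu> x) ^ card J)) \<partial>lborel)"
      unfolding tail by (subst nn_integral_chi2) measurable
    also have "(\<integral>\<^sup>+s. ?g s * (ennreal (1 - chi2_cdf \<nu> s) * f s) \<partial>lborel) + \<dots>
        = (\<integral>\<^sup>+s. ?g s * (ennreal (1 - chi2_cdf \<nu> s) * f s) + ennreal (chi2_pdf \<nu> s) * (f s * ennreal ((1 - chi2_cdf \<nu> s) ^ card J)) \<partial>lborel)"
      by (rule nn_integral_add[symmetric]) measurable
    also have "\<dots> = (\<integral>\<^sup>+s. ennreal (chi2_min_pdf (card (insert i J)) \<nu> s) * f s \<partial>lborel)"
    proof (rule nn_integral_cong)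
      fix s :: real
      obtain n where n: "card J = Suc n"
        using insert.hyps by (metis card_0_eq not0_implies_Suc)
      have le: "0 \<le> 1 - chi2_cdf \<nu> s" using chi2_cdf_le_1[OF \<nu>] by simp
      have "chi2_min_pdf (card (insert i J)) \<nu> s
          = chi2_min_pdf (card J) \<nu> s * (1 - chi2_cdf \<nu> s) + chi2_pdf \<nu> s * (1 - chi2_cdf \<nu> s) ^ card J"
        by (simp add: chi2_min_pdf_def n algebra_simps)
      also have "ennreal \<dots> = ?g s * ennreal (1 - chi2_cdf \<nu> s) + ennreal (chi2_pdf \<nu> s) * ennreal ((1 - chi2_cdf \<nu> s) ^ card J)"
        using le chi2_min_pdf_nonneg[OF \<nu>] by (simp add: ennreal_plus[symmetric] ennreal_mult[symmetric] del: ennreal_plus)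
      finally show "?g s * (ennreal (1 - chi2_cdf \<nu> s) * f s) + ennreal (chi2_pdf \<nu> s) * (f s * ennreal ((1 - chi2_cdf \<nu> s) ^ card J))
          = ennreal (chi2_min_pdf (card (insert i J)) \<nu> s) * f s"
        by (simp only:) (simp only: distrib_left distrib_right mult_ac)
    qed
    finally show ?case .
  }
qed

section \<open>Association of monotone functions\<close>

lemma integral_mult_ge_of_mono:
  fixes f g :: "'a::linorder \<Rightarrow> real"
  assumes M: "prob_space M" and [measurable]: "f \<in> borel_measurable M" "g \<in> borel_measurable M"
    and mono: "mono f" "mono g"
    and f: "\<And>x. 0 \<le> f x" "\<And>x. f x \<le> 1" and g: "\<And>x. 0 \<le> g x" "\<And>x. g x \<le> 1"
  shows "(LINT x|M. f x) * (LINT x|M. g x) \<le> (LINT x|M. f x * g x)"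
proof -
  interpret prob_space M by fact
  have [simp]: "integrable M f" "integrable M g" "integrable M (\<lambda>x. f x * g x)"
    using f g by (auto intro!: integrable_const_bound[where B=1] simp: mult_le_one)
  have "0 \<le> (LINT x|M. LINT y|M. (f x - f y) * (g x - g y))"
  proof (intro Bochner_Integration.integral_nonneg)
    fix x y
    show "0 \<le> (f x - f y) * (g x - g y)"
      using mono by (cases "x \<le> y") (auto simp: mono_def intro: mult_nonneg_nonneg mult_nonpos_nonpos)
  qed
  also have "(LINT x|M. LINT y|M. (f x - f y) * (g x - g y))
      = (LINT x|M. f x * g x - f x * (LINT y|M. g y) - (LINT y|M. f y) * g x + (LINT y|M. f y * g y))"
  proof (rule Bochner_Integration.integral_cong[OF refl])
    fix x
    have "(LINT y|M. (f x - f y) * (g x - g y)) = (LINT y|M. f x * g x - f x * g y - f y * g x + f y * g y)"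
      by (simp add: algebra_simps)
    then show "(LINT y|M. (f x - f y) * (g x - g y)) = f x * g x - f x * (LINT y|M. g y) - (LINT y|M. f y) * g x + (LINT y|M. f y * g y)"
      by (simp add: prob_space)
  qed
  also have "\<dots> = 2 * ((LINT x|M. f x * g x) - (LINT x|M. f x) * (LINT x|M. g x))"
    by (simp add: prob_space)
  finally show ?thesis by simp
qed

lemma integral_prod_ge_of_mono:
  fixes F :: "'i \<Rightarrow> 'a::linorder \<Rightarrow> real"
  assumes M: "prob_space M" and "finite I" and meas: "\<And>i. F i \<in> borel_measurable M" and mono: "\<And>i. mono (F i)"
    and F: "\<And>i x. 0 \<le> F i x" "\<And>i x. F i x \<le> 1"
  shows "(\<Prod>i\<in>I. (LINT x|M. F i x)) \<le> (LINT x|M. (\<Prod>i\<in>I. F i x))"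
  using assms(2)
proof induction
  case empty
  show ?case by (simp add: prob_space.prob_space[OF M])
next
  case (insert i I)
  have "mono (\<lambda>x. \<Prod>i\<in>I. F i x)"
    using mono F by (auto intro!: monoI prod_mono simp: mono_def)
  then have "(LINT x|M. F i x) * (LINT x|M. (\<Prod>i\<in>I. F i x)) \<le> (LINT x|M. F i x * (\<Prod>i\<in>I. F i x))"
    using meas mono F by (intro integral_mult_ge_of_mono M) (auto intro: prod_nonneg prod_le_1)
  moreover have "(LINT x|M. F i x) * (\<Prod>i\<in>I. (LINT x|M. F i x)) \<le> (LINT x|M. F i x) * (LINT x|M. (\<Prod>i\<in>I. F i x))"
    using insert.IH F by (intro mult_left_mono) (auto intro: Bochner_Integration.integral_nonneg)
  ultimately show ?case using insert.hyps by simp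
qed

section \<open>The selection bound\<close>

lemma Phi_eq_measure: "Phi t = measure std_normal {..t}"
proof -
  have eq: "emeasure std_normal {..t} = (\<integral>\<^sup>+u. ennreal (indicator {..t} u *\<^sub>R std_normal_density u) \<partial>lborel)"
    unfolding std_normal_def by (subst emeasure_density) (auto intro!: nn_integral_cong simp: indicator_def)
  have "integrable lborel (\<lambda>u. indicator {..t} u *\<^sub>R std_normal_density u)"
    using std_normal.emeasure_finite[of "{..t}"] unfolding eq
    by (intro integrableI_nonneg) (auto simp: less_top)
  then have "emeasure std_normal {..t} = ennreal (Phi t)"
    unfolding eq Phi_def set_lebesgue_integral_def by (subst nn_integral_eq_integral) auto
  then show ?thesis
    by (simp add: measure_def Phi_def set_lebesgue_integral_def Bochner_Integration.integral_nonneg)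
qed

lemma Phi_nonneg [simp]: "0 \<le> Phi t" and Phi_le_1 [simp]: "Phi t \<le> 1"
  by (simp_all add: Phi_eq_measure)

lemma mono_Phi: "mono Phi"
  by (intro monoI) (auto simp: Phi_eq_measure intro!: std_normal.finite_measure_mono)

lemma borel_measurable_Phi [measurable]: "Phi \<in> borel_measurable borel"
  by (rule borel_measurable_mono[OF mono_Phi])

lemma emeasure_std_normal_lessThan: "emeasure std_normal {..<t} = ennreal (Phi t)"
proof -
  have "emeasure std_normal {..<t} = emeasure std_normal {..t}"
    unfolding std_normal_def
    by (subst (1 2) emeasure_density) (auto intro!: nn_integral_cong_AE eventually_mono[OF AE_lborel_singleton[of t]] simp: indicator_def)
  then show ?thesis by (simp add: Phi_eq_measure std_normal.emeasure_eq_measure)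
qed

lemma Phi_nonpos_le_half:
  assumes "t \<le> 0"
  shows "Phi t \<le> 1 / 2"
proof -
  have "measure std_normal {..<0} = measure std_normal {0<..}"
  proof -
    have "(\<integral>\<^sup>+u. indicator {..<0} (- u) \<partial>std_normal) = (\<integral>\<^sup>+u. indicator {..<0} u \<partial>std_normal)"
      by (rule nn_integral_std_normal_uminus) simp
    moreover have "(\<integral>\<^sup>+u. indicator {..<0} (- u) \<partial>std_normal) = (\<integral>\<^sup>+u. indicator {0<..} u \<partial>std_normal)"
      by (intro nn_integral_cong) (auto simp: indicator_def)
    ultimately show ?thesis by (simp add: std_normal.emeasure_eq_measure)
  qed
  moreover have "measure std_normal {..<0} + measure std_normal {0<..} = measure std_normal ({..<0} \<union> {0<..})"
    by (rule std_normal.finite_measure_Union[symmetric]) auto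
  ultimately have "2 * measure std_normal {..<0} \<le> 1"
    using std_normal.prob_le_1[of "{..<0} \<union> {0<..}"] by linarith
  moreover have "measure std_normal {..<0} = Phi 0"
    using emeasure_std_normal_lessThan[of 0] by (simp add: measure_def)
  ultimately show ?thesis using monoD[OF mono_Phi assms] by simp
qed

lemma emeasure_std_normal_scaled:
  assumes "0 < r"
  shows "(\<integral>\<^sup>+u. indicator {..<\<delta>} (r * u) \<partial>std_normal) = ennreal (Phi (\<delta> / r))"
proof -
  have "(\<integral>\<^sup>+u. indicator {..<\<delta>} (r * u) \<partial>std_normal) = (\<integral>\<^sup>+u. indicator {..<\<delta> / r} u \<partial>std_normal)"
    using assms by (intro nn_integral_cong) (auto simp: indicator_def field_simps)
  then show ?thesis by (simp add: emeasure_std_normal_lessThan)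
qed

lemma AE_PiM_chi2_pos:
  assumes "1 \<le> \<nu>" and J: "finite J"
  shows "AE \<xi> in PiM J (\<lambda>_. chi2 \<nu>). \<forall>j\<in>J. 0 < \<xi> j"
proof (rule AE_ball_countable[THEN iffD2])
  show "countable J" using J by (rule countable_finite)
  have "AE x in chi2 \<nu>. 0 < x"
    unfolding chi2_def by (subst AE_density) (auto simp: chi2_pdf_def)
  then show "\<forall>j\<in>J. AE \<xi> in PiM J (\<lambda>_. chi2 \<nu>). 0 < \<xi> j"
    using prob_space_chi2[OF assms(1)] by (auto intro: AE_PiM_component)
qed

lemma mixture_selection_bound:
  fixes V :: "'i \<Rightarrow> ('j::finite \<Rightarrow> real) \<Rightarrow> real" and L :: "'i \<Rightarrow> real measure"
  assumes \<nu>: "1 \<le> \<nu>" and \<kappa>: "0 < \<kappa>" and \<delta>: "0 < \<delta>" and I: "finite I"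
    and L: "\<And>i. i \<in> insert s I \<Longrightarrow> prob_space (L i)"
    and L_sets: "\<And>i. i \<in> insert s I \<Longrightarrow> sets (L i) = sets borel"
    and V_meas: "\<And>i. i \<in> insert s I \<Longrightarrow> V i \<in> borel_measurable (PiM UNIV (\<lambda>_. borel))"
    and mix: "\<And>i f. i \<in> insert s I \<Longrightarrow> f \<in> borel_measurable borel \<Longrightarrow>
      (\<integral>\<^sup>+z. f z \<partial>L i) = (\<integral>\<^sup>+\<xi>. \<integral>\<^sup>+q. f (sqrt (V i \<xi>) * q) \<partial>std_normal \<partial>PiM UNIV (\<lambda>_. chi2 \<nu>))"
    and V: "\<And>i \<xi>. i \<in> insert s I \<Longrightarrow> (\<And>j. 0 < \<xi> j) \<Longrightarrow> 0 < V i \<xi> \<and> V i \<xi> \<le> \<kappa> / Min (range \<xi>)"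
  shows "(\<integral>\<^sup>+t. ennreal (chi2_min_pdf CARD('j) \<nu> t) *
      (\<integral>\<^sup>+u. ennreal (chi2_min_pdf CARD('j) \<nu> u) * ennreal (Phi (\<delta> / sqrt (\<kappa> * (1 / t + 1 / u)))) \<partial>lborel) ^ card I \<partial>lborel)
    \<le> (\<integral>\<^sup>+z. (\<Prod>i\<in>I. emeasure (L i) {..<\<delta> + z}) \<partial>L s)"
proof -
  let ?P = "PiM UNIV (\<lambda>_::'j. chi2 \<nu>)"
  let ?g = "\<lambda>t. ennreal (chi2_min_pdf CARD('j) \<nu> t)"
  let ?K = "\<lambda>t u. ennreal (Phi (\<delta> / sqrt (\<kappa> * (1 / t + 1 / u))))"
  note [measurable] = borel_measurable_chi2_min_pdf[OF \<nu>]
  interpret chi2: prob_space "chi2 \<nu>" using \<nu> by (rule prob_space_chi2)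
  interpret P: prob_space ?P by (rule prob_space_PiM) (rule prob_space_chi2[OF \<nu>])
  have Vm [measurable]: "V i \<in> borel_measurable ?P" if "i \<in> insert s I" for i
    using V_meas[OF that] by (simp cong: measurable_cong_sets sets_PiM_cong)
  have pos: "AE \<xi> in ?P. \<forall>j. 0 < \<xi> j" using AE_PiM_chi2_pos[OF \<nu>, of "UNIV :: 'j set"] by simp
  define F where "F i y = measure (L i) {..<y}" for i y
  have F_emeasure: "emeasure (L i) {..<y} = ennreal (F i y)" if "i \<in> insert s I" for i y
  proof -
    interpret prob_space "L i" using that by (rule L)
    show ?thesis by (simp add: F_def emeasure_eq_measure)
  qed
  have F_range: "0 \<le> F i y" "F i y \<le> 1" if "i \<in> insert s I" for i y
    using prob_space.prob_le_1[OF L[OF that]] by (auto simp: F_def)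
  have F_mono: "mono (F i)" if "i \<in> insert s I" for i
  proof (rule monoI)
    interpret prob_space "L i" using that by (rule L)
    fix x y :: real assume "x \<le> y"
    then show "F i x \<le> F i y" unfolding F_def
      by (intro finite_measure_mono) (auto simp: L_sets[OF that])
  qed
  have F_meas [measurable]: "F i \<in> borel_measurable borel" if "i \<in> insert s I" for i
    by (rule borel_measurable_mono[OF F_mono[OF that]])
  \<comment> \<open>\<open>V i\<close> is the conditional variance of \<open>L i\<close>, and \<open>r\<^sup>2\<close> that of \<open>L s\<close>.\<close>
  have inner: "(\<integral>\<^sup>+u. ?g u * ?K t u \<partial>lborel) \<le> (\<integral>\<^sup>+q. ennreal (F i (\<delta> + r * q)) \<partial>std_normal)"
    if i: "i \<in> insert s I" and t: "0 < t" and r: "0 \<le> r" "r\<^sup>2 \<le> \<kappa> / t" for i t r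
  proof -
    note [measurable] = Vm[OF i]
    have "(\<integral>\<^sup>+q. ennreal (F i (\<delta> + r * q)) \<partial>std_normal)
        = (\<integral>\<^sup>+q. \<integral>\<^sup>+\<xi>. \<integral>\<^sup>+z. indicator {..<\<delta> + r * q} (sqrt (V i \<xi>) * z) \<partial>std_normal \<partial>?P \<partial>std_normal)"
      by (simp add: F_emeasure[OF i, symmetric] L_sets[OF i] mix[OF i, symmetric] nn_integral_indicator[symmetric] del: nn_integral_indicator)
    also have "\<dots> = (\<integral>\<^sup>+q. \<integral>\<^sup>+\<xi>. \<integral>\<^sup>+z. indicator {..<\<delta>} ((- r) * q + sqrt (V i \<xi>) * z) \<partial>std_normal \<partial>?P \<partial>std_normal)"
      by (intro nn_integral_cong) (auto simp: indicator_def)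
    also have "\<dots> = (\<integral>\<^sup>+\<xi>. \<integral>\<^sup>+q. \<integral>\<^sup>+z. indicator {..<\<delta>} ((- r) * q + sqrt (V i \<xi>) * z) \<partial>std_normal \<partial>std_normal \<partial>?P)"
      by (rule pair_sigma_finite.Fubini')
        (auto simp: pair_sigma_finite_def std_normal.sigma_finite_measure_axioms P.sigma_finite_measure_axioms)
    also have "\<dots> = (\<integral>\<^sup>+\<xi>. \<integral>\<^sup>+q. indicator {..<\<delta>} (sqrt (r\<^sup>2 + (sqrt (V i \<xi>))\<^sup>2) * q) \<partial>std_normal \<partial>?P)"
      by (subst nn_integral_std_normal_add) auto
    also have "\<dots> \<ge> (\<integral>\<^sup>+\<xi>. ?K t (Min (range \<xi>)) \<partial>?P)"
    proof (rule nn_integral_mono_AE, rule eventually_mono[OF pos])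
      fix \<xi> :: "'j \<Rightarrow> real" assume \<xi>: "\<forall>j. 0 < \<xi> j"
      define m where "m = Min (range \<xi>)"
      have m: "0 < m" unfolding m_def using \<xi> by (subst Min_gr_iff) auto
      have Vi: "0 < V i \<xi>" "V i \<xi> \<le> \<kappa> / m" using V[OF i, of \<xi>] \<xi> by (auto simp: m_def)
      have "0 < r\<^sup>2 + V i \<xi>" using Vi by (simp add: add_nonneg_pos)
      moreover have "r\<^sup>2 + V i \<xi> \<le> \<kappa> * (1 / t + 1 / m)"
        using Vi r by (simp add: distrib_left)
      ultimately have "\<delta> / sqrt (\<kappa> * (1 / t + 1 / m)) \<le> \<delta> / sqrt (r\<^sup>2 + V i \<xi>)"
        using \<delta> by (intro divide_left_mono) auto
      then have "?K t m \<le> ennreal (Phi (\<delta> / sqrt (r\<^sup>2 + V i \<xi>)))"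
        by (intro ennreal_leI monoD[OF mono_Phi])
      also have "\<dots> = (\<integral>\<^sup>+q. indicator {..<\<delta>} (sqrt (r\<^sup>2 + (sqrt (V i \<xi>))\<^sup>2) * q) \<partial>std_normal)"
        using \<open>0 < r\<^sup>2 + V i \<xi>\<close> Vi by (subst emeasure_std_normal_scaled) auto
      finally show "?K t (Min (range \<xi>)) \<le> (\<integral>\<^sup>+q. indicator {..<\<delta>} (sqrt (r\<^sup>2 + (sqrt (V i \<xi>))\<^sup>2) * q) \<partial>std_normal)"
        by (simp add: m_def)
    qed
    also have "(\<integral>\<^sup>+\<xi>. ?K t (Min (range \<xi>)) \<partial>?P) = (\<integral>\<^sup>+u. ?g u * ?K t u \<partial>lborel)"
      by (rule nn_integral_PiM_chi2_Min[OF _ _ \<nu>, of "UNIV :: 'j set" "?K t"]) auto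
    finally show ?thesis .
  qed
  let ?H = "\<lambda>t. (\<integral>\<^sup>+u. ?g u * ?K t u \<partial>lborel) ^ card I"
  have "(\<integral>\<^sup>+t. ?g t * ?H t \<partial>lborel) = (\<integral>\<^sup>+\<xi>. ?H (Min (range \<xi>)) \<partial>?P)"
    by (rule nn_integral_PiM_chi2_Min[OF _ _ \<nu>, of "UNIV :: 'j set" ?H, symmetric]) auto
  also have "\<dots> \<le> (\<integral>\<^sup>+\<xi>. \<integral>\<^sup>+q. ennreal (\<Prod>i\<in>I. F i (\<delta> + sqrt (V s \<xi>) * q)) \<partial>std_normal \<partial>?P)"
  proof (rule nn_integral_mono_AE, rule eventually_mono[OF pos])
    fix \<xi> :: "'j \<Rightarrow> real" assume \<xi>: "\<forall>j. 0 < \<xi> j"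
    define m where "m = Min (range \<xi>)"
    have m: "0 < m" unfolding m_def using \<xi> by (subst Min_gr_iff) auto
    have Vs: "0 < V s \<xi>" "V s \<xi> \<le> \<kappa> / m" using V[of s \<xi>] \<xi> by (auto simp: m_def)
    let ?F = "\<lambda>i q. if i \<in> I then F i (\<delta> + sqrt (V s \<xi>) * q) else 0"
    have [measurable]: "?F i \<in> borel_measurable borel" for i
      using F_meas[of i] by (cases "i \<in> I") auto
    have Fr: "0 \<le> ?F i q" "?F i q \<le> 1" for i q using F_range[of i] by auto
    have "?H m = (\<Prod>i\<in>I. (\<integral>\<^sup>+u. ?g u * ?K m u \<partial>lborel))" by simp
    also have "\<dots> \<le> (\<Prod>i\<in>I. (\<integral>\<^sup>+q. ennreal (F i (\<delta> + sqrt (V s \<xi>) * q)) \<partial>std_normal))"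
      using Vs m by (intro prod_mono_ennreal inner) auto
    also have "\<dots> = (\<Prod>i\<in>I. ennreal (LINT q|std_normal. ?F i q))"
      using F_range by (intro prod.cong refl) (subst nn_integral_eq_integral[symmetric],
        auto intro!: std_normal.integrable_const_bound[where B=1] nn_integral_cong)
    also have "\<dots> = ennreal (\<Prod>i\<in>I. (LINT q|std_normal. ?F i q))"
      by (rule prod_ennreal) (rule Bochner_Integration.integral_nonneg, rule Fr)
    also have "\<dots> \<le> ennreal (LINT q|std_normal. (\<Prod>i\<in>I. ?F i q))"
    proof (intro ennreal_leI integral_prod_ge_of_mono prob_space_std_normal I Fr)
      fix i
      show "mono (?F i)"
        using F_mono[of i] Vs by (auto simp: mono_def intro!: mult_left_mono)
    qed measurable
    also have "\<dots> = (\<integral>\<^sup>+q. ennreal (\<Prod>i\<in>I. ?F i q) \<partial>std_normal)"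
      using F_range by (intro nn_integral_eq_integral[symmetric] std_normal.integrable_const_bound[where B=1])
        (auto simp: abs_prod intro!: prod_nonneg prod_le_1)
    finally show "?H (Min (range \<xi>)) \<le> (\<integral>\<^sup>+q. ennreal (\<Prod>i\<in>I. F i (\<delta> + sqrt (V s \<xi>) * q)) \<partial>std_normal)"
      by (simp add: m_def)
  qed
  also have "\<dots> = (\<integral>\<^sup>+z. ennreal (\<Prod>i\<in>I. F i (\<delta> + z)) \<partial>L s)"
    by (rule mix[symmetric]) (auto intro!: borel_measurable_prod measurable_compose[OF _ F_meas])
  also have "\<dots> = (\<integral>\<^sup>+z. (\<Prod>i\<in>I. emeasure (L i) {..<\<delta> + z}) \<partial>L s)"
    using F_range by (intro nn_integral_cong) (simp add: F_emeasure prod_ennreal)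
  finally show ?thesis .
qed

lemma (in prob_space) indep_vars_reindex:
  assumes indep: "indep_vars M' X I" and inj: "inj_on f J" and sub: "f ` J \<subseteq> I"
  shows "indep_vars (\<lambda>j. M' (f j)) (\<lambda>j. X (f j)) J"
proof -
  have "indep_vars (\<lambda>j. PiM {f j} M') (\<lambda>j \<omega>. restrict (\<lambda>i. X i \<omega>) {f j}) J"
    using inj sub by (intro indep_vars_restrict[OF indep]) (auto simp: disjoint_family_on_def inj_on_def)
  then have "indep_vars (\<lambda>j. M' (f j)) (\<lambda>j \<omega>. (\<lambda>z. z (f j)) (restrict (\<lambda>i. X i \<omega>) {f j})) J"
    by (rule indep_vars_compose2) simp
  then show ?thesis by simp
qed

lemma (in prob_space) emeasure_all_less_indep:
  fixes D :: "'i \<Rightarrow> 'a \<Rightarrow> real"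
  assumes indep: "indep_vars (\<lambda>_. borel) D (insert s I)" and I: "finite I" "s \<notin> I"
  shows "emeasure M {\<omega> \<in> space M. \<forall>i\<in>I. D i \<omega> < \<delta> + D s \<omega>}
    = (\<integral>\<^sup>+z. (\<Prod>i\<in>I. emeasure (distr M borel (D i)) {..<\<delta> + z}) \<partial>distr M borel (D s))"
proof -
  have [measurable]: "D i \<in> borel_measurable M" if "i \<in> insert s I" for i
    using indep that by (auto simp: indep_vars_def)
  define L where "L i = (if i \<in> insert s I then distr M borel (D i) else return borel 0)" for i
  have L_prob: "prob_space (L i)" for i
    by (auto simp: L_def intro!: prob_space_distr prob_space_return)
  have L_sets: "sets (L i) = sets borel" for i by (auto simp: L_def)
  interpret L: product_prob_space L by (auto intro: product_prob_spaceI L_prob)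
  let ?A = "\<lambda>z. \<forall>i\<in>I. z i < \<delta> + z s"
  have D: "distr M (PiM (insert s I) (\<lambda>_. borel)) (\<lambda>\<omega>. \<lambda>i\<in>insert s I. D i \<omega>) = PiM (insert s I) L"
    using indep_vars_iff_distr_eq_PiM'[of "insert s I" D "\<lambda>_. borel"] indep
    by (auto simp: L_def intro!: PiM_cong)
  have sets_eq: "sets (PiM (insert s I) L) = sets (PiM (insert s I) (\<lambda>_. borel))"
    by (intro sets_PiM_cong refl L_sets)
  have m1: "indicator {z. ?A z} \<in> borel_measurable (PiM (insert s I) (\<lambda>_. borel :: real measure))"
  proof -
    have "Measurable.pred (PiM (insert s I) (\<lambda>_. borel :: real measure)) ?A"
      using I by (intro pred_intros_finite) (auto intro!: borel_measurable_pred_less)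
    then show ?thesis by (intro borel_measurable_indicator') (simp add: pred_def)
  qed
  have m2: "indicator {z. ?A z} \<in> borel_measurable (PiM (insert s I) L)"
    using m1 by (simp cong: measurable_cong_sets add: sets_eq)
  have [measurable]: "{\<omega> \<in> space M. ?A (\<lambda>i. D i \<omega>)} \<in> sets M"
    using I by (intro sets.sets_Collect_finite_All) auto
  have "emeasure M {\<omega> \<in> space M. ?A (\<lambda>i. D i \<omega>)}
      = (\<integral>\<^sup>+\<omega>. indicator {z. ?A z} (\<lambda>i\<in>insert s I. D i \<omega>) \<partial>M)"
  proof -
    have "emeasure M {\<omega> \<in> space M. ?A (\<lambda>i. D i \<omega>)} = (\<integral>\<^sup>+\<omega>. indicator {\<omega> \<in> space M. ?A (\<lambda>i. D i \<omega>)} \<omega> \<partial>M)"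
      by simp
    also have "\<dots> = (\<integral>\<^sup>+\<omega>. indicator {z. ?A z} (\<lambda>i\<in>insert s I. D i \<omega>) \<partial>M)"
      by (intro nn_integral_cong) (auto simp: indicator_def)
    finally show ?thesis .
  qed
  also have "\<dots> = (\<integral>\<^sup>+z. indicator {z. ?A z} z \<partial>PiM (insert s I) L)"
    unfolding D[symmetric] using m1 by (subst nn_integral_distr) auto
  also have "\<dots> = (\<integral>\<^sup>+y. (\<integral>\<^sup>+z. indicator {z. ?A z} (z(s := y)) \<partial>PiM I L) \<partial>L s)"
    by (rule L.product_nn_integral_insert_rev[OF I m2])
  also have "\<dots> = (\<integral>\<^sup>+y. (\<Prod>i\<in>I. emeasure (L i) {..<\<delta> + y}) \<partial>L s)"
  proof (rule nn_integral_cong)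
    fix y
    have "(\<integral>\<^sup>+z. indicator {z. ?A z} (z(s := y)) \<partial>PiM I L) = (\<integral>\<^sup>+z. indicator (Pi\<^sub>E I (\<lambda>_. {..<\<delta> + y})) z \<partial>PiM I L)"
      using I by (intro nn_integral_cong) (auto simp: indicator_def space_PiM PiE_iff)
    also have "\<dots> = (\<Prod>i\<in>I. emeasure (L i) {..<\<delta> + y})"
      using I by (subst nn_integral_indicator) (auto intro!: sets_PiM_I_finite L.emeasure_PiM simp: L_sets)
    finally show "(\<integral>\<^sup>+z. indicator {z. ?A z} (z(s := y)) \<partial>PiM I L) = (\<Prod>i\<in>I. emeasure (L i) {..<\<delta> + y})" .
  qed
  also have "\<dots> = (\<integral>\<^sup>+z. (\<Prod>i\<in>I. emeasure (distr M borel (D i)) {..<\<delta> + z}) \<partial>distr M borel (D s))"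
    by (simp add: L_def)
  finally show ?thesis .
qed

lemma nn_integral_chi2_min_pdf:
  assumes "1 \<le> m" "1 \<le> \<nu>"
  shows "(\<integral>\<^sup>+s. ennreal (chi2_min_pdf m \<nu> s) \<partial>lborel) = 1"
proof -
  interpret P: prob_space "PiM {..<m} (\<lambda>_. chi2 \<nu>)"
    by (rule prob_space_PiM) (rule prob_space_chi2[OF assms(2)])
  show ?thesis
    using nn_integral_PiM_chi2_Min[of "{..<m}" \<nu> "\<lambda>_. 1"] assms P.emeasure_space_1
    by (auto simp: lessThan_empty_iff)
qed

lemma ennreal_LINT_chi2_min_pdf:
  assumes m: "1 \<le> m" and \<nu>: "1 \<le> \<nu>" and [measurable]: "f \<in> borel_measurable borel"
    and f: "\<And>s. 0 \<le> f s" "\<And>s. f s \<le> 1"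
  shows "ennreal (LINT s:{0<..}|lborel. f s * chi2_min_pdf m \<nu> s)
    = (\<integral>\<^sup>+s. ennreal (chi2_min_pdf m \<nu> s) * ennreal (f s) \<partial>lborel)"
proof -
  note [measurable] = borel_measurable_chi2_min_pdf[OF \<nu>]
  note [simp] = chi2_min_pdf_nonneg[OF \<nu>]
  have int: "integrable lborel (chi2_min_pdf m \<nu>)"
    by (intro integrableI_nonneg) (auto simp: nn_integral_chi2_min_pdf[OF m \<nu>])
  have eq: "indicator {0<..} s *\<^sub>R (f s * chi2_min_pdf m \<nu> s) = chi2_min_pdf m \<nu> s * f s" for s
    by (auto simp: indicator_def chi2_min_pdf_def chi2_pdf_def)
  have "integrable lborel (\<lambda>s. chi2_min_pdf m \<nu> s * f s)"
    by (rule Bochner_Integration.integrable_bound[OF int]) (use f in \<open>auto simp: abs_mult intro!: mult_left_le\<close>)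
  then show ?thesis
    unfolding set_lebesgue_integral_def eq
    using f by (subst nn_integral_eq_integral[symmetric]) (auto simp: ennreal_mult)
qed

lemma LINT_chi2_min_pdf_bounds:
  assumes m: "1 \<le> m" and \<nu>: "1 \<le> \<nu>" and f_meas [measurable]: "f \<in> borel_measurable borel"
    and f: "\<And>s. 0 \<le> f s" "\<And>s. f s \<le> c" and c: "c \<le> 1"
  shows "0 \<le> (LINT s:{0<..}|lborel. f s * chi2_min_pdf m \<nu> s)"
    and "(LINT s:{0<..}|lborel. f s * chi2_min_pdf m \<nu> s) \<le> c"
proof -
  note [measurable] = borel_measurable_chi2_min_pdf[OF \<nu>]
  show "0 \<le> (LINT s:{0<..}|lborel. f s * chi2_min_pdf m \<nu> s)"
    unfolding set_lebesgue_integral_def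
    by (intro Bochner_Integration.integral_nonneg) (auto simp: f chi2_min_pdf_nonneg[OF \<nu>])
  have "0 \<le> c" using f[of 0] by simp
  have "ennreal (LINT s:{0<..}|lborel. f s * chi2_min_pdf m \<nu> s)
      = (\<integral>\<^sup>+s. ennreal (chi2_min_pdf m \<nu> s) * ennreal (f s) \<partial>lborel)"
    using f c by (intro ennreal_LINT_chi2_min_pdf[OF m \<nu>]) (auto intro: order_trans)
  also have "\<dots> \<le> (\<integral>\<^sup>+s. ennreal (chi2_min_pdf m \<nu> s) * ennreal c \<partial>lborel)"
    using f by (intro nn_integral_mono mult_left_mono ennreal_leI) auto
  also have "\<dots> = ennreal c"
    by (subst nn_integral_multc) (auto simp: nn_integral_chi2_min_pdf[OF m \<nu>])
  finally show "(LINT s:{0<..}|lborel. f s * chi2_min_pdf m \<nu> s) \<le> c"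
    using \<open>0 \<le> c\<close> by simp
qed

lemma measurable_fd_mean:
  assumes [measurable]: "\<And>l. (\<lambda>w. z w l) \<in> borel_measurable M"
  shows "(\<lambda>w. fd_mean h \<delta> n0 (z w)) \<in> borel_measurable M"
proof -
  have "(\<lambda>w. fd_N h \<delta> n0 (z w)) \<in> M \<rightarrow>\<^sub>M count_space UNIV"
    unfolding fd_N_def fd_first_var_def fd_first_mean_def by measurable
  then show ?thesis
    unfolding fd_mean_def
    by (rule measurable_compose_countable[where g="\<lambda>w. fd_N h \<delta> n0 (z w)" and f="\<lambda>n w. (\<Sum>l<n. z w l) / real n", rotated])
      measurable
qed

section \<open>Regression weights and the defining equation\<close>

definition regression_weights :: "('m::finite \<Rightarrow> real^'p::finite) \<Rightarrow> real^'p \<Rightarrow> real^'m" where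
  "regression_weights xd x = design_matrix xd *v
     (matrix_inv (transpose (design_matrix xd) ** design_matrix xd) *v x)"

lemma matrix_inv_mult:
  fixes A :: "real^'n^'n"
  assumes "invertible A"
  shows "A ** matrix_inv A = mat 1" "matrix_inv A ** A = mat 1"
proof -
  have "A ** matrix_inv A = mat 1 \<and> matrix_inv A ** A = mat 1"
    unfolding matrix_inv_def by (rule someI_ex) (use assms in \<open>simp add: invertible_def\<close>)
  then show "A ** matrix_inv A = mat 1" "matrix_inv A ** A = mat 1" by auto
qed

context
  fixes xd :: "'m::finite \<Rightarrow> real^'p::finite"
  assumes A2: "invertible (transpose (design_matrix xd) ** design_matrix xd)"
begin

abbreviation (input) "XM \<equiv> design_matrix xd"
abbreviation (input) "XI \<equiv> matrix_inv (transpose XM ** XM)"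

lemma transpose_design_regression_weights: "transpose XM *v regression_weights xd x = x"
  using matrix_inv_mult(1)[OF A2]
  by (simp add: regression_weights_def matrix_vector_mul_assoc matrix_mul_assoc)

lemma inner_regression_weights: "regression_weights xd x \<bullet> (XM *v u) = x \<bullet> u"
  using transpose_design_regression_weights[of x]
  by (metis dot_lmul_matrix vector_transpose_matrix transpose_transpose)

lemma inner_fd_beta: "x \<bullet> fd_beta xd yh = (\<Sum>j\<in>UNIV. regression_weights xd x $ j * yh j)"
proof -
  have "x \<bullet> fd_beta xd yh = regression_weights xd x \<bullet> (XM *v fd_beta xd yh)"
    by (simp add: inner_regression_weights)
  also have "\<dots> = (XM *v (XI *v x)) \<bullet> (XM *v fd_beta xd yh)"
    by (simp add: regression_weights_def)
  also have "\<dots> = (XI *v x) \<bullet> (transpose XM *v (XM *v fd_beta xd yh))"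
    by (metis dot_lmul_matrix vector_transpose_matrix inner_commute)
  also have "transpose XM *v (XM *v fd_beta xd yh) = transpose XM *v (\<chi> j. yh j)"
    using matrix_inv_mult(1)[OF A2]
    by (simp add: fd_beta_def matrix_vector_mul_assoc matrix_mul_assoc)
  also have "(XI *v x) \<bullet> \<dots> = regression_weights xd x \<bullet> (\<chi> j. yh j)"
    by (metis regression_weights_def dot_lmul_matrix vector_transpose_matrix inner_commute)
  finally show ?thesis by (simp add: inner_vec_def)
qed

lemma inner_matrix_inv_eq: "x \<bullet> (XI *v x) = (\<Sum>j\<in>UNIV. (regression_weights xd x $ j)\<^sup>2)"
proof -
  have "x \<bullet> (XI *v x) = regression_weights xd x \<bullet> regression_weights xd x"
    using inner_regression_weights[of x "XI *v x"] by (simp add: regression_weights_def)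
  then show ?thesis by (simp add: inner_vec_def power2_eq_square)
qed

lemma inner_matrix_inv_pos:
  assumes "x \<noteq> 0"
  shows "0 < x \<bullet> (XI *v x)"
proof -
  have "regression_weights xd x \<noteq> 0"
    using transpose_design_regression_weights[of x] assms by (metis matrix_vector_mult_0_right)
  then have "0 < regression_weights xd x \<bullet> regression_weights xd x" by simp
  then show ?thesis unfolding inner_matrix_inv_eq by (simp add: inner_vec_def power2_eq_square)
qed

lemma sum_regression_weights: "(\<Sum>j\<in>UNIV. regression_weights xd x $ j * (xd j \<bullet> u)) = x \<bullet> u"
  using inner_regression_weights[of x u]
  by (simp add: inner_vec_def[of "regression_weights xd x"] matrix_vector_mul_component design_matrix_def)

end

lemma argmax_alt_correct:
  assumes "0 < k"
  shows "argmax_alt k b x < k" "\<And>i. i < k \<Longrightarrow> x \<bullet> b i \<le> x \<bullet> b (argmax_alt k b x)"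
proof -
  let ?A = "(\<lambda>i. x \<bullet> b i) ` {..<k}"
  have "Max ?A \<in> ?A" using assms by (intro Max_in) auto
  then obtain i where "i < k" "Max ?A = x \<bullet> b i" by auto
  then have "i < k \<and> (\<forall>i'<k. x \<bullet> b i' \<le> x \<bullet> b i)" by (metis Max_ge finite_imageI finite_lessThan imageI lessThan_iff)
  then have "argmax_alt k b x < k \<and> (\<forall>i'<k. x \<bullet> b i' \<le> x \<bullet> b (argmax_alt k b x))"
    unfolding argmax_alt_def by (rule LeastI)
  then show "argmax_alt k b x < k" "\<And>i. i < k \<Longrightarrow> x \<bullet> b i \<le> x \<bullet> b (argmax_alt k b x)" by auto
qed

lemma het_integrand_kernel_bounds:
  fixes xd :: "'m::finite \<Rightarrow> real^'p::finite" and h :: real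
  assumes \<nu>: "2 \<le> n0"
  defines "v x \<equiv> x \<bullet> (matrix_inv (transpose (design_matrix xd) ** design_matrix xd) *v x)"
  defines "K x t \<equiv> (LINT s:{0<..}|lborel. Phi (h / sqrt ((real n0 - 1) * (1 / t + 1 / s) * v x)) * chi2_min_pdf CARD('m) (n0 - 1) s)"
  shows "het_integrand k n0 xd h x = (LINT t:{0<..}|lborel. K x t ^ (k - 1) * chi2_min_pdf CARD('m) (n0 - 1) t)"
    and "K x \<in> borel_measurable borel"
    and "0 \<le> K x t" and "K x t \<le> 1"
    and "ennreal (K x t) = (\<integral>\<^sup>+s. ennreal (chi2_min_pdf CARD('m) (n0 - 1) s) *
      ennreal (Phi (h / sqrt ((real n0 - 1) * (1 / t + 1 / s) * v x))) \<partial>lborel)"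
    and "\<lbrakk>h \<le> 0; 0 \<le> v x; 0 < t\<rbrakk> \<Longrightarrow> K x t \<le> 1 / 2"
proof -
  have 1: "1 \<le> n0 - 1" "1 \<le> CARD('m)" using \<nu> by (auto simp: Suc_le_eq)
  note [measurable] = borel_measurable_chi2_min_pdf[OF 1(1)]
  show "het_integrand k n0 xd h x = (LINT t:{0<..}|lborel. K x t ^ (k - 1) * chi2_min_pdf CARD('m) (n0 - 1) t)"
    by (simp add: het_integrand_def Let_def K_def v_def)
  show "K x \<in> borel_measurable borel"
    unfolding K_def set_lebesgue_integral_def by measurable
  show "0 \<le> K x t" "K x t \<le> 1"
    unfolding K_def using 1 by (auto intro!: LINT_chi2_min_pdf_bounds)
  show "ennreal (K x t) = (\<integral>\<^sup>+s. ennreal (chi2_min_pdf CARD('m) (n0 - 1) s) *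
      ennreal (Phi (h / sqrt ((real n0 - 1) * (1 / t + 1 / s) * v x))) \<partial>lborel)"
    unfolding K_def using 1 by (intro ennreal_LINT_chi2_min_pdf) auto
  assume h: "h \<le> 0" "0 \<le> v x" "0 < t"
  have "K x t = (LINT s:{0<..}|lborel. (if 0 < s then Phi (h / sqrt ((real n0 - 1) * (1 / t + 1 / s) * v x)) else 0) * chi2_min_pdf CARD('m) (n0 - 1) s)"
    unfolding K_def by (intro set_lebesgue_integral_cong) auto
  also have "\<dots> \<le> 1 / 2"
  proof (rule LINT_chi2_min_pdf_bounds(2)[OF 1(2,1)])
    fix s :: real
    show "(if 0 < s then Phi (h / sqrt ((real n0 - 1) * (1 / t + 1 / s) * v x)) else 0) \<le> 1 / 2"
    proof (cases "0 < s")
      case True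
      have "h / sqrt ((real n0 - 1) * (1 / t + 1 / s) * v x) \<le> 0"
        using h \<nu> True by (intro divide_nonpos_nonneg) auto
      from Phi_nonpos_le_half[OF this] show ?thesis using True by simp
    qed simp
  qed auto
  finally show "K x t \<le> 1 / 2" .
qed

lemma ennreal_het_integrand:
  fixes xd :: "'m::finite \<Rightarrow> real^'p::finite"
  assumes n0: "2 \<le> n0"
  shows "ennreal (het_integrand k n0 xd h x) = (\<integral>\<^sup>+t. ennreal (chi2_min_pdf CARD('m) (n0 - 1) t) *
      (\<integral>\<^sup>+s. ennreal (chi2_min_pdf CARD('m) (n0 - 1) s) *
        ennreal (Phi (h / sqrt ((real n0 - 1) * (1 / t + 1 / s) *
          (x \<bullet> (matrix_inv (transpose (design_matrix xd) ** design_matrix xd) *v x))))) \<partial>lborel) ^ (k - 1) \<partial>lborel)"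
proof -
  note K = het_integrand_kernel_bounds[OF n0, where xd=xd and h=h and x=x]
  show ?thesis
    unfolding K(1) K(5)[symmetric] using n0 K(2-4)
    by (subst ennreal_LINT_chi2_min_pdf) (auto simp: ennreal_power power_le_one Suc_le_eq)
qed

lemma het_integrand_nonneg:
  assumes "2 \<le> n0"
  shows "0 \<le> het_integrand k n0 xd h x"
  unfolding het_integrand_kernel_bounds(1)[OF assms]
  using assms het_integrand_kernel_bounds(2-4)[OF assms, where xd=xd and h=h and x=x]
  by (intro LINT_chi2_min_pdf_bounds(1)[where c=1]) (auto simp: power_le_one Suc_le_eq)

lemma het_integrand_le_of_nonpos:
  fixes xd :: "'m::finite \<Rightarrow> real^'p::finite"
  assumes n0: "2 \<le> n0" and k: "1 \<le> k" and h: "h \<le> 0"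
    and A2: "invertible (transpose (design_matrix xd) ** design_matrix xd)"
  shows "het_integrand k n0 xd h x \<le> 1 / real k"
proof -
  note K = het_integrand_kernel_bounds[OF n0, where xd=xd and h=h and x=x]
  have v: "0 \<le> x \<bullet> (matrix_inv (transpose (design_matrix xd) ** design_matrix xd) *v x)"
    unfolding inner_matrix_inv_eq[OF A2] by (intro sum_nonneg) simp
  let ?K = "\<lambda>t. LINT s:{0<..}|lborel. Phi (h / sqrt ((real n0 - 1) * (1 / t + 1 / s) *
     (x \<bullet> (matrix_inv (transpose (design_matrix xd) ** design_matrix xd) *v x)))) * chi2_min_pdf CARD('m) (n0 - 1) s"
  have [measurable]: "?K \<in> borel_measurable borel" by (rule K(2))
  have "het_integrand k n0 xd h x = (LINT t:{0<..}|lborel. (if 0 < t then ?K t ^ (k - 1) else 0) * chi2_min_pdf CARD('m) (n0 - 1) t)"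
    unfolding K(1) by (intro set_lebesgue_integral_cong) auto
  also have "\<dots> \<le> (1 / 2) ^ (k - 1)"
    using n0 K(3) K(6)[OF h v]
    by (intro LINT_chi2_min_pdf_bounds(2)) (auto simp: power_mono power_le_one Suc_le_eq)
  also have "\<dots> \<le> 1 / real k"
  proof -
    have "k \<le> 2 ^ (k - 1)" using less_exp[of "k - 1"] k by linarith
    then have "real k \<le> 2 ^ (k - 1)" by (metis of_nat_le_iff of_nat_numeral of_nat_power)
    then show ?thesis using k by (simp add: power_one_over field_simps)
  qed
  finally show ?thesis .
qed

section \<open>Validity of the procedure\<close>

lemma FDHet_select_near_optimal:
  assumes k: "0 < k" and s: "s < k" "\<And>i. i < k \<Longrightarrow> x \<bullet> \<beta> i \<le> x \<bullet> \<beta> s"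
    and est: "\<And>i. i < k \<Longrightarrow> x \<bullet> fd_beta xd (\<lambda>j. fd_mean h \<delta> n0 (\<lambda>l. Y i l j \<omega>)) = x \<bullet> \<beta> i + D i"
    and less: "\<And>i. i < k \<Longrightarrow> i \<noteq> s \<Longrightarrow> D i < \<delta> + D s" and \<delta>: "0 < \<delta>"
  shows "(MAX i\<in>{..<k}. x \<bullet> \<beta> i) - x \<bullet> \<beta> (FDHet_select k h \<delta> n0 xd Y x \<omega>) < \<delta>"
proof -
  define c where "c = FDHet_select k h \<delta> n0 xd Y x \<omega>"
  let ?b = "\<lambda>i. fd_beta xd (\<lambda>j. fd_mean h \<delta> n0 (\<lambda>l. Y i l j \<omega>))"
  have c: "c < k"
    unfolding c_def FDHet_select_def by (rule argmax_alt_correct(1)[OF k])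
  have "x \<bullet> ?b s \<le> x \<bullet> ?b c"
    unfolding c_def FDHet_select_def by (rule argmax_alt_correct(2)[OF k s(1)])
  then have "x \<bullet> \<beta> s + D s \<le> x \<bullet> \<beta> c + D c"
    by (simp only: est[OF c] est[OF s(1)])
  then have "x \<bullet> \<beta> s - x \<bullet> \<beta> c < \<delta>"
    using c less[of c] \<delta> by (cases "c = s") auto
  moreover have "(MAX i\<in>{..<k}. x \<bullet> \<beta> i) = x \<bullet> \<beta> s"
    using s by (intro Max_eqI) auto
  ultimately show ?thesis by (simp add: c_def)
qed

lemma FDHet_PCS_pred_measurable:
  fixes xd :: "'m::finite \<Rightarrow> real^'p::finite"
  assumes Y: "\<And>i l j. i < k \<Longrightarrow> Y i l j \<in> borel_measurable M"
    and A2: "invertible (transpose (design_matrix xd) ** design_matrix xd)"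
    and k: "0 < k"
  shows "Measurable.pred (borel \<Otimes>\<^sub>M M) (\<lambda>(x, \<omega>). (MAX i\<in>{..<k}. x \<bullet> \<beta> i) - x \<bullet> \<beta> (FDHet_select k h \<delta> n0 xd Y x \<omega>) < \<delta>)"
proof -
  let ?e = "\<lambda>i p. fst p \<bullet> fd_beta xd (\<lambda>j. fd_mean h \<delta> n0 (\<lambda>l. Y i l j (snd p)))"
  have [measurable]: "(\<lambda>x. regression_weights xd x $ j) \<in> borel_measurable borel" for j
    unfolding regression_weights_def
    by (intro borel_measurable_continuous_onI continuous_intros matrix_vector_mult_linear_continuous_on
        continuous_on_compose2[OF matrix_vector_mult_linear_continuous_on])  auto
  have e [measurable]: "?e i \<in> borel_measurable (borel \<Otimes>\<^sub>M M)" if "i < k" for i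
  proof -
    have [measurable]: "(\<lambda>\<omega>. fd_mean h \<delta> n0 (\<lambda>l. Y i l j \<omega>)) \<in> borel_measurable M" for j
      by (rule measurable_fd_mean) (rule Y[OF that])
    show ?thesis unfolding inner_fd_beta[OF A2] by measurable
  qed
  have "Measurable.pred (borel \<Otimes>\<^sub>M M) (\<lambda>p. i < k \<and> (\<forall>i'<k. ?e i' p \<le> ?e i p))" for i
  proof (cases "i < k")
    case True
    have "Measurable.pred (borel \<Otimes>\<^sub>M M) (\<lambda>p. ?e i' p \<le> ?e i p)" if "i' < k" for i'
      unfolding pred_def by (rule borel_measurable_le[OF e[OF that] e[OF True]])
    then have "Measurable.pred (borel \<Otimes>\<^sub>M M) (\<lambda>p. \<forall>i'\<in>{..<k}. ?e i' p \<le> ?e i p)"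
      by (intro pred_intros_finite) auto
    then show ?thesis using True by (simp add: Ball_def)
  qed simp
  then have [measurable]: "(\<lambda>p. FDHet_select k h \<delta> n0 xd Y (fst p) (snd p)) \<in> borel \<Otimes>\<^sub>M M \<rightarrow>\<^sub>M count_space UNIV"
    unfolding FDHet_select_def argmax_alt_def by (rule measurable_Least)
  have [measurable]: "(\<lambda>p. fst p \<bullet> \<beta> (FDHet_select k h \<delta> n0 xd Y (fst p) (snd p))) \<in> borel_measurable (borel \<Otimes>\<^sub>M M)"
    by (rule measurable_compose_countable[where g="\<lambda>p. FDHet_select k h \<delta> n0 xd Y (fst p) (snd p)"
      and f="\<lambda>i p. fst p \<bullet> \<beta> i"]) measurable
  have "(\<lambda>p. MAX i\<in>{..<k}. fst p \<bullet> \<beta> i) \<in> borel_measurable (borel \<Otimes>\<^sub>M M)"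
    by (rule borel_measurable_Max) auto
  then show ?thesis
    unfolding case_prod_beta pred_def by (intro borel_measurable_less borel_measurable_diff) auto
qed

lemma borel_measurable_FDHet_PCS:
  fixes xd :: "'m::finite \<Rightarrow> real^'p::finite"
  assumes M: "prob_space M" and Y: "\<And>i l j. i < k \<Longrightarrow> Y i l j \<in> borel_measurable M"
    and A2: "invertible (transpose (design_matrix xd) ** design_matrix xd)"
    and k: "0 < k"
  shows "FDHet_PCS M k h \<delta> n0 xd Y \<beta> \<in> borel_measurable borel"
proof -
  interpret prob_space M by fact
  let ?Q = "{p \<in> space (borel \<Otimes>\<^sub>M M). (\<lambda>(x, \<omega>). (MAX i\<in>{..<k}. x \<bullet> \<beta> i) - x \<bullet> \<beta> (FDHet_select k h \<delta> n0 xd Y x \<omega>) < \<delta>) p}"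
  have "?Q \<in> sets (borel \<Otimes>\<^sub>M M)"
    by (rule FDHet_PCS_pred_measurable[OF Y A2 k, unfolded pred_def])
  then have "(\<lambda>x. measure M (Pair x -` ?Q)) \<in> borel_measurable borel"
    unfolding measure_def by (intro borel_measurable_enn2real measurable_emeasure_Pair)
  moreover have "Pair x -` ?Q = {w \<in> space M. (MAX i\<in>{..<k}. x \<bullet> \<beta> i) - x \<bullet> \<beta> (FDHet_select k h \<delta> n0 xd Y x w) < \<delta>}" for x
    by (auto simp: space_pair_measure)
  ultimately show ?thesis
    by (simp add: FDHet_PCS_def[abs_def])
qed

lemma FDHet_PCS_ge_het_integrand:
  fixes M :: "'a measure" and xd :: "'m::finite \<Rightarrow> real^'p::finite"
    and Y :: "nat \<Rightarrow> nat \<Rightarrow> 'm \<Rightarrow> 'a \<Rightarrow> real"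
  assumes M: "prob_space M"
    and normal: "\<And>i l j. i < k \<Longrightarrow>
          distributed M lborel (Y i l j) (\<lambda>y. ennreal (normal_density (\<mu> i j) (\<sigma> i j) y))"
    and \<mu>: "\<And>i j. \<mu> i j = xd j \<bullet> \<beta> i"
    and \<sigma>: "\<And>i j. i < k \<Longrightarrow> 0 < \<sigma> i j"
    and indep: "prob_space.indep_vars M (\<lambda>_. borel) (\<lambda>(i, l, j). Y i l j) ({..<k} \<times> UNIV \<times> UNIV)"
    and A2: "invertible (transpose (design_matrix xd) ** design_matrix xd)"
    and k: "1 \<le> k" and \<delta>: "0 < \<delta>" and n0: "2 \<le> n0" and h: "0 < h" and x: "x \<noteq> 0"
  shows "het_integrand k n0 xd h x \<le> FDHet_PCS M k h \<delta> n0 xd Y \<beta> x"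
proof -
  interpret prob_space M by fact
  define a where "a = regression_weights xd x"
  define v where "v = x \<bullet> (matrix_inv (transpose (design_matrix xd) ** design_matrix xd) *v x)"
  have v: "v = (\<Sum>j\<in>UNIV. (a $ j)\<^sup>2)" "0 < v"
    using inner_matrix_inv_eq[OF A2, of x] inner_matrix_inv_pos[OF A2 x] by (auto simp: v_def a_def)
  define Z where "Z = (\<lambda>t \<omega>. (\<lambda>(i, l, j) y. (y - \<mu> i j) / \<sigma> i j) t ((\<lambda>(i, l, j). Y i l j) t \<omega>))"
  have indepZ: "indep_vars (\<lambda>_. borel) Z ({..<k} \<times> UNIV \<times> UNIV)"
    unfolding Z_def by (rule indep_vars_compose2[OF indep]) auto
  have lawZ: "distr M borel (Z (i, l, j)) = std_normal" if "i < k" for i l j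
  proof -
    have "distributed M lborel (\<lambda>\<omega>. (Y i l j \<omega> - \<mu> i j) / \<sigma> i j) (\<lambda>x. ennreal (std_normal_density x))"
      using normal[OF that] normal_standard_normal_convert[OF \<sigma>[OF that]] by simp
    from distributed_distr_eq_density[OF this] show ?thesis
      by (simp add: Z_def std_normal_def cong: distr_cong)
  qed
  define N where "N i j w = max (nat \<lceil>h\<^sup>2 * ((\<sigma> i j)\<^sup>2 * w / (real n0 - 1)) / \<delta>\<^sup>2\<rceil>) n0" for i j w
  have N_meas [measurable]: "N i j \<in> borel \<rightarrow>\<^sub>M count_space UNIV" for i j
    unfolding N_def[abs_def] by measurable
  have N_meas_real [measurable]: "(\<lambda>w. real (N i j w)) \<in> borel_measurable borel" for i j
    by (rule measurable_compose[OF N_meas]) simp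
  have N_ge: "n0 \<le> N i j w" for i j w by (simp add: N_def)
  have N_ge': "h\<^sup>2 * ((\<sigma> i j)\<^sup>2 * w / (real n0 - 1)) / \<delta>\<^sup>2 \<le> real (N i j w)" for i j w
    unfolding N_def by linarith
  define T where "T i j z = (sq_dev n0 z, norm_sum (N i j (sq_dev n0 z)) z)" for i j and z :: "nat \<Rightarrow> real"
  define P where "P = (\<lambda>(i, j) \<omega>. T i j (\<lambda>l. Z (i, l, j) \<omega>))"
  have lawP: "distr M (borel \<Otimes>\<^sub>M borel) (P (i, j)) = chi2 (n0 - 1) \<Otimes>\<^sub>M std_normal" if "i < k" for i j
  proof -
    have "indep_vars (\<lambda>_. borel) (\<lambda>l. Z (i, l, j)) UNIV"
      using indep_vars_reindex[OF indepZ, of "\<lambda>l. (i, l, j)" UNIV] that by (auto simp: inj_on_def)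
    from distr_sq_dev_norm_sum[OF this lawZ[OF that] n0 N_meas N_ge]
    show ?thesis by (simp add: P_def T_def)
  qed
  have indepP: "indep_vars (\<lambda>_. borel \<Otimes>\<^sub>M borel) P ({..<k} \<times> UNIV)"
  proof -
    define K where "K = (\<lambda>(i, j). range (\<lambda>l. (i, l, j)) :: (nat \<times> nat \<times> 'm) set)"
    have "indep_vars (\<lambda>q. PiM (K q) (\<lambda>_. borel)) (\<lambda>q \<omega>. restrict (\<lambda>t. Z t \<omega>) (K q)) ({..<k} \<times> UNIV)"
      by (rule indep_vars_restrict[OF indepZ]) (auto simp: K_def disjoint_family_on_def)
    then have "indep_vars (\<lambda>_. borel \<Otimes>\<^sub>M borel)
      (\<lambda>q \<omega>. (\<lambda>(i, j) z. T i j (\<lambda>l. z (i, l, j))) q (restrict (\<lambda>t. Z t \<omega>) (K q))) ({..<k} \<times> UNIV)"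
    proof (rule indep_vars_compose2)
      fix q assume "q \<in> {..<k} \<times> (UNIV :: 'm set)"
      obtain i j where q: "q = (i, j)" by (cases q)
      have [measurable]: "(\<lambda>z. z (i, l, j)) \<in> borel_measurable (PiM (K (i, j)) (\<lambda>_. borel :: real measure))" for l
        by (rule measurable_component_singleton) (auto simp: K_def)
      have "(\<lambda>z. norm_sum (N i j (sq_dev n0 (\<lambda>l. z (i, l, j)))) (\<lambda>l. z (i, l, j))) \<in> borel_measurable (PiM (K (i, j)) (\<lambda>_. borel))"
        by (rule measurable_compose_countable[where g="\<lambda>z. N i j (sq_dev n0 (\<lambda>l. z (i, l, j)))"
          and f="\<lambda>n z. norm_sum n (\<lambda>l. z (i, l, j))"]) measurable
      then show "(\<lambda>(i, j) z. T i j (\<lambda>l. z (i, l, j))) q \<in> PiM (K q) (\<lambda>_. borel) \<rightarrow>\<^sub>M borel \<Otimes>\<^sub>M borel"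
        unfolding q T_def prod.case by measurable
    qed
    moreover have "(\<lambda>q \<omega>. (\<lambda>(i, j) z. T i j (\<lambda>l. z (i, l, j))) q (restrict (\<lambda>t. Z t \<omega>) (K q))) = P"
      by (auto simp: fun_eq_iff P_def K_def)
    ultimately show ?thesis by (simp only:)
  qed
  define b where "b i j w = a $ j * \<sigma> i j / sqrt (real (N i j w))" for i j w
  have b_meas [measurable]: "b i j \<in> borel_measurable borel" for i j
    unfolding b_def[abs_def] by measurable
  define D where "D i \<omega> = (\<Sum>j\<in>UNIV. b i j (fst (P (i, j) \<omega>)) * snd (P (i, j) \<omega>))" for i \<omega>
  have indepD: "indep_vars (\<lambda>_. borel) D {..<k}"
  proof -
    have "indep_vars (\<lambda>i. PiM ({i} \<times> (UNIV :: 'm set)) (\<lambda>_. borel \<Otimes>\<^sub>M borel)) (\<lambda>i \<omega>. restrict (\<lambda>q. P q \<omega>) ({i} \<times> UNIV)) {..<k}"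
      by (rule indep_vars_restrict[OF indepP]) (auto simp: disjoint_family_on_def)
    then have "indep_vars (\<lambda>_. borel)
      (\<lambda>i \<omega>. (\<lambda>p. \<Sum>j\<in>UNIV. b i j (fst (p (i, j))) * snd (p (i, j))) (restrict (\<lambda>q. P q \<omega>) ({i} \<times> UNIV))) {..<k}"
    proof (rule indep_vars_compose2)
      fix i :: nat
      have [measurable]: "(\<lambda>p. p (i, j)) \<in> PiM ({i} \<times> (UNIV :: 'm set)) (\<lambda>_. borel \<Otimes>\<^sub>M borel :: (real \<times> real) measure) \<rightarrow>\<^sub>M borel \<Otimes>\<^sub>M borel" for j
        by (rule measurable_component_singleton) auto
      show "(\<lambda>p. \<Sum>j\<in>UNIV. b i j (fst (p (i, j))) * snd (p (i, j))) \<in> PiM ({i} \<times> UNIV) (\<lambda>_. borel \<Otimes>\<^sub>M borel) \<rightarrow>\<^sub>M borel"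
        by measurable
    qed
    then show ?thesis by (simp add: D_def[abs_def])
  qed
  have D_meas: "D i \<in> borel_measurable M" if "i < k" for i
    using indepD that by (auto simp: indep_vars_def)
  define V where "V i \<xi> = (\<Sum>j\<in>UNIV. (b i j (\<xi> j))\<^sup>2)" for i \<xi>
  have lawD: "(\<integral>\<^sup>+z. f z \<partial>distr M borel (D i))
      = (\<integral>\<^sup>+\<xi>. \<integral>\<^sup>+q. f (sqrt (V i \<xi>) * q) \<partial>std_normal \<partial>PiM UNIV (\<lambda>_. chi2 (n0 - 1)))"
    if i: "i < k" and f [measurable]: "f \<in> borel_measurable borel" for i f
  proof -
    have P_meas: "P (i, j) \<in> M \<rightarrow>\<^sub>M borel \<Otimes>\<^sub>M borel" for j
      using indepP i by (auto simp: indep_vars_def)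
    have "indep_vars (\<lambda>_. borel \<Otimes>\<^sub>M borel) (\<lambda>j. P (i, j)) UNIV"
      using indep_vars_reindex[OF indepP, of "\<lambda>j. (i, j)" UNIV] i by (auto simp: inj_on_def)
    then have joint: "distr M (PiM UNIV (\<lambda>_. borel \<Otimes>\<^sub>M borel)) (\<lambda>\<omega>. \<lambda>j\<in>UNIV. P (i, j) \<omega>)
        = PiM UNIV (\<lambda>_. chi2 (n0 - 1) \<Otimes>\<^sub>M std_normal)"
      using indep_vars_iff_distr_eq_PiM'[of UNIV "\<lambda>j. P (i, j)" "\<lambda>_. borel \<Otimes>\<^sub>M borel"] P_meas
      by (simp add: lawP[OF i])
    have "(\<integral>\<^sup>+z. f z \<partial>distr M borel (D i)) = (\<integral>\<^sup>+\<omega>. f (D i \<omega>) \<partial>M)"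
      using D_meas[OF i] by (subst nn_integral_distr) auto
    also have "\<dots> = (\<integral>\<^sup>+p. f (\<Sum>j\<in>UNIV. b i j (fst (p j)) * snd (p j)) \<partial>PiM UNIV (\<lambda>_. chi2 (n0 - 1) \<Otimes>\<^sub>M std_normal))"
      unfolding joint[symmetric] using P_meas by (subst nn_integral_distr) (auto simp: D_def intro!: measurable_restrict)
    also have "\<dots> = (\<integral>\<^sup>+\<xi>. \<integral>\<^sup>+q. f (sqrt (V i \<xi>) * q) \<partial>std_normal \<partial>PiM UNIV (\<lambda>_. chi2 (n0 - 1)))"
      using nn_integral_PiM_weighted_sum[of "UNIV :: 'm set" "chi2 (n0 - 1)" "b i" "\<lambda>(\<xi>, S). f S"] n0
      by (simp add: prob_space_chi2 V_def)
    finally show ?thesis .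
  qed
  define \<kappa> where "\<kappa> = (\<delta> / h)\<^sup>2 * (real n0 - 1) * v"
  have \<kappa>: "0 < \<kappa>" using \<delta> h n0 v by (simp add: \<kappa>_def)
  have V_bound: "0 < V i \<xi> \<and> V i \<xi> \<le> \<kappa> / Min (range \<xi>)" if i: "i < k" and \<xi>: "\<And>j. 0 < \<xi> j" for i and \<xi> :: "'m \<Rightarrow> real"
  proof
    have N_pos: "0 < real (N i j w)" for j w using N_ge[of i j w] n0 by simp
    have b2: "(b i j w)\<^sup>2 = (a $ j)\<^sup>2 * ((\<sigma> i j)\<^sup>2 / real (N i j w))" for j w
      using N_pos[of j w] by (simp add: b_def power_mult_distrib power_divide)
    obtain j where "a $ j \<noteq> 0"
      using v by (metis (mono_tags, lifting) less_irrefl power_zero_numeral sum.neutral)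
    then have "0 < (b i j (\<xi> j))\<^sup>2"
      unfolding b2 using N_pos[of j "\<xi> j"] \<sigma>[OF i, of j] by simp
    then show "0 < V i \<xi>"
      unfolding V_def by (intro sum_pos2[of _ j]) auto
    define m where "m = Min (range \<xi>)"
    have m: "0 < m" unfolding m_def using \<xi> by (subst Min_gr_iff) auto
    have "(\<sigma> i j)\<^sup>2 / real (N i j (\<xi> j)) \<le> (\<delta> / h)\<^sup>2 * (real n0 - 1) / m" for j
    proof -
      have "m \<le> \<xi> j" unfolding m_def by (intro Min_le) auto
      have "(\<sigma> i j)\<^sup>2 * (h\<^sup>2 * m) \<le> (\<sigma> i j)\<^sup>2 * (h\<^sup>2 * \<xi> j)"
        using \<open>m \<le> \<xi> j\<close> by (intro mult_left_mono) auto
      also have "\<dots> \<le> real (N i j (\<xi> j)) * (\<delta>\<^sup>2 * (real n0 - 1))"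
        using N_ge'[of i j "\<xi> j"] \<delta> n0 by (simp add: field_simps)
      finally show ?thesis
        using m h n0 N_pos[of j "\<xi> j"] by (simp add: field_simps power_divide)
    qed
    then have "V i \<xi> \<le> (\<Sum>j\<in>UNIV. (a $ j)\<^sup>2 * ((\<delta> / h)\<^sup>2 * (real n0 - 1) / m))"
      unfolding V_def b2 by (intro sum_mono mult_left_mono) auto
    also have "\<dots> = \<kappa> / m"
      by (simp only: sum_distrib_right[symmetric] v(1)[symmetric] \<kappa>_def) simp
    finally show "V i \<xi> \<le> \<kappa> / Min (range \<xi>)" by (simp add: m_def)
  qed
  obtain s where s: "s < k" "\<And>i. i < k \<Longrightarrow> x \<bullet> \<beta> i \<le> x \<bullet> \<beta> s"
    using k argmax_alt_correct[where k=k and b=\<beta> and x=x] by (metis less_le_trans zero_less_one)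
  define I where "I = {..<k} - {s}"
  have I: "finite I" "s \<notin> I" "insert s I = {..<k}" "card I = k - 1" using s(1) by (auto simp: I_def)
  have kernel: "\<delta> / sqrt (\<kappa> * c) = h / sqrt ((real n0 - 1) * c * v)" for c
  proof -
    have "\<kappa> * c = (\<delta> / h)\<^sup>2 * ((real n0 - 1) * c * v)" by (simp add: \<kappa>_def)
    then have "sqrt (\<kappa> * c) = \<delta> / h * sqrt ((real n0 - 1) * c * v)"
      using \<delta> h by (simp only: real_sqrt_mult real_sqrt_abs) simp
    then show ?thesis using \<delta> h by simp
  qed
  have "ennreal (het_integrand k n0 xd h x)
      \<le> (\<integral>\<^sup>+z. (\<Prod>i\<in>I. emeasure (distr M borel (D i)) {..<\<delta> + z}) \<partial>distr M borel (D s))"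
    unfolding ennreal_het_integrand[OF n0] v_def[symmetric] kernel[symmetric] I(4)[symmetric]
  proof (rule mixture_selection_bound[where V=V])
    fix i assume "i \<in> insert s I"
    then have i: "i < k" using I by simp
    show "prob_space (distr M borel (D i))" using D_meas[OF i] by (rule prob_space_distr)
    show "V i \<in> borel_measurable (PiM UNIV (\<lambda>_. borel))"
      unfolding V_def[abs_def] by measurable
  qed (use I n0 \<kappa> \<delta> lawD V_bound in auto)
  also have "\<dots> = emeasure M {\<omega> \<in> space M. \<forall>i\<in>I. D i \<omega> < \<delta> + D s \<omega>}"
    using emeasure_all_less_indep[of D s I \<delta>] indepD I by simp
  also have "\<dots> \<le> emeasure M {\<omega> \<in> space M. (MAX i\<in>{..<k}. x \<bullet> \<beta> i) - x \<bullet> \<beta> (FDHet_select k h \<delta> n0 xd Y x \<omega>) < \<delta>}"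
  proof (rule emeasure_mono)
    have Y_meas: "Y i l j \<in> borel_measurable M" if "i < k" for i l j
      using distributed_measurable[OF normal[OF that]] by simp
    have "Measurable.pred M (\<lambda>\<omega>. (\<lambda>(x, \<omega>). (MAX i\<in>{..<k}. x \<bullet> \<beta> i) - x \<bullet> \<beta> (FDHet_select k h \<delta> n0 xd Y x \<omega>) < \<delta>) (x, \<omega>))"
      using k by (intro measurable_compose[OF _ FDHet_PCS_pred_measurable[OF Y_meas A2]]) auto
    then show "{\<omega> \<in> space M. (MAX i\<in>{..<k}. x \<bullet> \<beta> i) - x \<bullet> \<beta> (FDHet_select k h \<delta> n0 xd Y x \<omega>) < \<delta>} \<in> sets M"
      by (simp add: pred_def)
    show "{\<omega> \<in> space M. \<forall>i\<in>I. D i \<omega> < \<delta> + D s \<omega>}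
      \<subseteq> {\<omega> \<in> space M. (MAX i\<in>{..<k}. x \<bullet> \<beta> i) - x \<bullet> \<beta> (FDHet_select k h \<delta> n0 xd Y x \<omega>) < \<delta>}"
    proof safe
      fix \<omega> assume less: "\<forall>i\<in>I. D i \<omega> < \<delta> + D s \<omega>"
      show "(MAX i\<in>{..<k}. x \<bullet> \<beta> i) - x \<bullet> \<beta> (FDHet_select k h \<delta> n0 xd Y x \<omega>) < \<delta>"
      proof (rule FDHet_select_near_optimal[where s=s and D="\<lambda>i. D i \<omega>"])
        fix i assume i: "i < k"
        have "fd_mean h \<delta> n0 (\<lambda>l. Y i l j \<omega>) = \<mu> i j + \<sigma> i j / sqrt (N i j (fst (P (i, j) \<omega>))) * snd (P (i, j) \<omega>)" for j
        proof -
          let ?z = "\<lambda>l. Z (i, l, j) \<omega>"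
          have eq: "(\<lambda>l. Y i l j \<omega>) = (\<lambda>l. \<mu> i j + \<sigma> i j * ?z l)"
            using \<sigma>[OF i, of j] by (simp add: Z_def)
          have "N i j (sq_dev n0 ?z) = fd_N h \<delta> n0 (\<lambda>l. \<mu> i j + \<sigma> i j * ?z l)"
            unfolding fd_N_def fd_first_var_affine[OF n0] N_def ..
          from fd_mean_affine[OF n0 this] show ?thesis
            unfolding eq by (simp add: P_def T_def)
        qed
        then show "x \<bullet> fd_beta xd (\<lambda>j. fd_mean h \<delta> n0 (\<lambda>l. Y i l j \<omega>)) = x \<bullet> \<beta> i + D i \<omega>"
          unfolding inner_fd_beta[OF A2] a_def[symmetric] D_def b_def
          using sum_regression_weights[OF A2, of x "\<beta> i"]
          by (simp add: \<mu> distrib_left sum.distrib a_def mult.assoc)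
      qed (use less \<delta> k s in \<open>auto simp: I_def\<close>)
    qed
  qed
  also have "\<dots> = ennreal (FDHet_PCS M k h \<delta> n0 xd Y \<beta> x)"
    by (simp add: FDHet_PCS_def emeasure_eq_measure)
  finally show ?thesis by (simp add: FDHet_PCS_def)
qed

theorem theorem2:
  fixes M :: "'a measure" and k n0 :: nat
    and xd :: "'m::finite \<Rightarrow> real^'p::finite" and p0 :: 'p
    and \<beta> :: "nat \<Rightarrow> real^'p" and \<sigma> :: "nat \<Rightarrow> real^'p \<Rightarrow> real"
    and Y :: "nat \<Rightarrow> nat \<Rightarrow> 'm \<Rightarrow> 'a \<Rightarrow> real"
    and PX :: "(real^'p) measure" and \<Theta> :: "(real^'p) set"
    and \<alpha> \<delta> h :: real
  assumes M: "prob_space M"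
    and A1_normal: "\<And>i l j. i < k \<Longrightarrow>
          distributed M lborel (Y i l j) (\<lambda>y. ennreal (normal_density (xd j \<bullet> \<beta> i) (\<sigma> i (xd j)) y))"
    and A1_sigma: "\<And>i j. i < k \<Longrightarrow> 0 < \<sigma> i (xd j)"
    and A1_indep: "prob_space.indep_vars M (\<lambda>_. borel) (\<lambda>(i, l, j). Y i l j) ({..<k} \<times> UNIV \<times> UNIV)"
    and Theta: "\<Theta> \<subseteq> {x. x $ p0 = 1}" "\<Theta> \<noteq> {}"
    and PX: "prob_space PX" "sets PX = sets borel" "AE x in PX. x \<in> \<Theta>"
    and design: "\<And>j. xd j \<in> \<Theta>"
    and A2: "invertible (transpose (design_matrix xd) ** design_matrix xd)"
    and k: "2 \<le> k"
    and alpha: "1 / real k < 1 - \<alpha>" "1 - \<alpha> < 1"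
    and delta: "0 < \<delta>"
    and n0: "2 \<le> n0"
  shows "((LINT x|PX. het_integrand k n0 xd h x) = 1 - \<alpha> \<longrightarrow>
            (LINT x|PX. FDHet_PCS M k h \<delta> n0 xd Y \<beta> x) \<ge> 1 - \<alpha>)
       \<and> ((INF x\<in>\<Theta>. het_integrand k n0 xd h x) = 1 - \<alpha> \<longrightarrow>
            (INF x\<in>\<Theta>. FDHet_PCS M k h \<delta> n0 xd Y \<beta> x) \<ge> 1 - \<alpha>)"
proof (intro conjI impI)
  interpret M: prob_space M by fact
  interpret PX: prob_space PX by fact
  have ge: "het_integrand k n0 xd h x \<le> FDHet_PCS M k h \<delta> n0 xd Y \<beta> x" if "0 < h" "x \<in> \<Theta>" for x
  proof (rule FDHet_PCS_ge_het_integrand[OF M A1_normal refl A1_sigma A1_indep A2 _ delta n0 that(1)])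
    show "x \<noteq> 0" using that(2) Theta(1) by auto
  qed (use k in auto)
  have h_le: "het_integrand k n0 xd h x \<le> 1 / real k" if "h \<le> 0" for x
    using k by (intro het_integrand_le_of_nonpos[OF n0 _ that A2]) simp
  have pos: "0 < 1 - \<alpha>" using alpha(1) by (rule le_less_trans[rotated]) simp
  {
    assume eq: "(LINT x|PX. het_integrand k n0 xd h x) = 1 - \<alpha>"
    then have int: "integrable PX (\<lambda>x. het_integrand k n0 xd h x)"
      using pos not_integrable_integral_eq by fastforce
    have "0 < h"
    proof (rule ccontr)
      assume "\<not> 0 < h"
      then have "(LINT x|PX. het_integrand k n0 xd h x) \<le> 1 / real k"
        using h_le by (intro PX.integral_le_const[OF int]) auto
      then show False using eq alpha(1) by simp
    qed
    have "FDHet_PCS M k h \<delta> n0 xd Y \<beta> \<in> borel_measurable PX"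
      using borel_measurable_FDHet_PCS[OF M _ A2, of k Y] distributed_measurable[OF A1_normal] k
      by (simp cong: measurable_cong_sets add: PX(2))
    then have "integrable PX (FDHet_PCS M k h \<delta> n0 xd Y \<beta>)"
      by (intro PX.integrable_const_bound[where B=1]) (auto simp: FDHet_PCS_def)
    then have "(LINT x|PX. het_integrand k n0 xd h x) \<le> (LINT x|PX. FDHet_PCS M k h \<delta> n0 xd Y \<beta> x)"
      using PX(3) ge[OF \<open>0 < h\<close>] by (intro integral_mono_AE int) (auto elim: eventually_mono)
    then show "1 - \<alpha> \<le> (LINT x|PX. FDHet_PCS M k h \<delta> n0 xd Y \<beta> x)" using eq by simp
  next
    assume eq: "(INF x\<in>\<Theta>. het_integrand k n0 xd h x) = 1 - \<alpha>"
    have le: "1 - \<alpha> \<le> het_integrand k n0 xd h x" if "x \<in> \<Theta>" for x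
      unfolding eq[symmetric] using that het_integrand_nonneg[OF n0]
      by (intro cINF_lower bdd_belowI2[where m=0]) auto
    obtain x0 where "x0 \<in> \<Theta>" using Theta(2) by auto
    have "0 < h"
      using le[OF \<open>x0 \<in> \<Theta>\<close>] h_le[of x0] alpha(1) by fastforce
    then show "1 - \<alpha> \<le> (INF x\<in>\<Theta>. FDHet_PCS M k h \<delta> n0 xd Y \<beta> x)"
      using le ge Theta(2) by (intro cINF_greatest) (auto intro: order_trans)
  }
qed

end
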